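(* Let $q\ge 2$ be an integer. Let $\mathrm{Toep}(T_q)$ be the set of all branching-Toeplitz kernels on $T_q$, and let $B_{\mathrm{Toep}}(\ell^2(T_q)) := \mathrm{Toep}(T_q)\cap B(\ell^2(T_q))$ be the set of branching-Toeplitz kernels that represent bounded operators on $\ell^2(T_q)$. Then $$B_{\mathrm{Toep}}(\ell^2(T_q)) = \{\Gamma_q[f] : f\in L^\infty(\mathbb{T})\}.$$ Moreover, for any $f\in L^\infty(\mathbb{T})$, the operator norm satisfies $\|\Gamma_q[f]\| = \|f\|_\infty$.
   Context: $T_q$ denotes the (vertex set of the) infinite rooted $q$-homogeneous tree: there is a root $o$, and each vertex has exactly $q$ children. $d$ is the graph distance and $|\sigma| := d(o,\sigma)$. Write $\sigma_1\preccurlyeq\sigma_2$ if $\sigma_1,\sigma_2$ lie on a common geodesic ray starting at the root and $|\sigma_1|\le|\sigma_2|$. Let $\mathcal{C}\subset T_q\times T_q$ be the set of comparable pairs ($\sigma_1\preccurlyeq\sigma_2$ or $\sigma_2\preccurlyeq\sigma_1$), with indicator function $\mathbf{1}_{\mathcal{C}}$. A branching-Toeplitz kernel on $T_q$ is a function $T_q\times T_q\to\mathbb{C}$ of the form $K_\alpha(\sigma_1,\sigma_2)=\alpha(|\sigma_1|-|\sigma_2|)\,\mathbf{1}_{\mathcal{C}}(\sigma_1,\sigma_2)$ for some function $\alpha:\mathbb{Z}\to\mathbb{C}$. $\mathbb{T}=\mathbb{R}/2\pi\mathbb{Z}$. A formal Fourier series $f\sim\sum_{n\in\mathbb{Z}}\widehat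 f(n)e^{in\theta}$ is an arbitrary sequence $(\widehat f(n))_{n\in\mathbb{Z}}$ of complex numbers; a function $f\in L^1(\mathbb{T})$ is identified with the series with coefficients $\widehat f(n)=\int_{\mathbb{T}} f(e^{i\theta})e^{-in\theta}\frac{d\theta}{2\pi}$. For a formal Fourier series $f$, $$\Gamma_q[f](\sigma_1,\sigma_2) := q^{-d(\sigma_1,\sigma_2)/2}\,\widehat f(|\sigma_1|-|\sigma_2|)\,\mathbf{1}_{\mathcal{C}}(\sigma_1,\sigma_2).$$ A bounded operator $A$ on $\ell^2(T_q)$ is identified with its kernel $A(\sigma_1,\sigma_2)=\langle A\delta_{\sigma_2},\delta_{\sigma_1}\rangle$; a kernel represents a bounded operator if it is the kernel of some element of $B(\ell^2(T_q))$. *)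

theory Defs
  imports "HOL-Probability.Probability"
begin

section \<open>The rooted homogeneous tree\<close>

text \<open>
  Vertices of the rooted \<open>q\<close>-homogeneous tree are the finite words over the alphabet
  \<open>{0, \<dots>, q - 1}\<close>; the root is the empty word and the children of \<open>\<sigma>\<close> are the words
  \<open>\<sigma> @ [i]\<close> with \<open>i < q\<close>.
\<close>

definition tree_vertices :: "nat \<Rightarrow> nat list set" where
  "tree_vertices q = lists {..<q}"

definition tree_edges :: "nat \<Rightarrow> (nat list \<times> nat list) set" where
  "tree_edges q =
     {(\<sigma>, \<tau>). \<sigma> \<in> tree_vertices q \<and> \<tau> \<in> tree_vertices q \<and>
               (\<exists>i. \<tau> = \<sigma> @ [i] \<or> \<sigma> = \<tau> @ [i])}"

definition tree_dist :: "nat \<Rightarrow> nat list \<Rightarrow> nat list \<Rightarrow> nat" where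
  "tree_dist q \<sigma> \<tau> = (LEAST n. (\<sigma>, \<tau>) \<in> tree_edges q ^^ n)"

definition tree_level :: "nat \<Rightarrow> nat list \<Rightarrow> nat" where
  "tree_level q \<sigma> = tree_dist q [] \<sigma>"

definition geodesic_ray_from_root :: "nat \<Rightarrow> (nat \<Rightarrow> nat list) \<Rightarrow> bool" where
  "geodesic_ray_from_root q r \<longleftrightarrow>
     r 0 = [] \<and> (\<forall>n. r n \<in> tree_vertices q) \<and>
     (\<forall>m n. m \<le> n \<longrightarrow> tree_dist q (r m) (r n) = n - m)"

definition tree_le :: "nat \<Rightarrow> nat list \<Rightarrow> nat list \<Rightarrow> bool" where
  "tree_le q \<sigma> \<tau> \<longleftrightarrow>
     (\<exists>r. geodesic_ray_from_root q r \<and> \<sigma> \<in> range r \<and> \<tau> \<in> range r) \<and>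
     tree_level q \<sigma> \<le> tree_level q \<tau>"

definition comparable_pairs :: "nat \<Rightarrow> (nat list \<times> nat list) set" where
  "comparable_pairs q =
     {(\<sigma>, \<tau>) \<in> tree_vertices q \<times> tree_vertices q. tree_le q \<sigma> \<tau> \<or> tree_le q \<tau> \<sigma>}"


section \<open>Kernels\<close>

text \<open>
  A kernel on the tree is a function of two words that vanishes unless both words are
  vertices, so that equality of kernels is equality of functions. For the kernels below
  this is automatic from the factor \<open>indicator (comparable_pairs q)\<close>.
\<close>

definition toeplitz_kernel ::
    "nat \<Rightarrow> (int \<Rightarrow> complex) \<Rightarrow> nat list \<Rightarrow> nat list \<Rightarrow> complex" where
  "toeplitz_kernel q \<alpha> \<sigma> \<tau> =
     \<alpha> (int (tree_level q \<sigma>) - int (tree_level q \<tau>)) * indicator (comparable_pairs q) (\<sigma>, \<tau>)"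

definition Toep :: "nat \<Rightarrow> (nat list \<Rightarrow> nat list \<Rightarrow> complex) set" where
  "Toep q = range (toeplitz_kernel q)"

text \<open>A formal Fourier series is its coefficient sequence \<open>c\<close>.\<close>

definition Gamma_kernel ::
    "nat \<Rightarrow> (int \<Rightarrow> complex) \<Rightarrow> nat list \<Rightarrow> nat list \<Rightarrow> complex" where
  "Gamma_kernel q c \<sigma> \<tau> =
     of_real (real q powr (- real (tree_dist q \<sigma> \<tau>) / 2)) *
     c (int (tree_level q \<sigma>) - int (tree_level q \<tau>)) *
     indicator (comparable_pairs q) (\<sigma>, \<tau>)"


section \<open>Bounded operators on the square-summable functions\<close>

definition l2 :: "nat \<Rightarrow> (nat list \<Rightarrow> complex) set" where
  "l2 q = {x. (\<forall>\<sigma>. \<sigma> \<notin> tree_vertices q \<longrightarrow> x \<sigma> = 0) \<and>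
              (\<lambda>\<sigma>. (cmod (x \<sigma>))\<^sup>2) summable_on tree_vertices q}"

definition l2_inner :: "nat \<Rightarrow> (nat list \<Rightarrow> complex) \<Rightarrow> (nat list \<Rightarrow> complex) \<Rightarrow> complex" where
  "l2_inner q x y = (\<Sum>\<^sub>\<infinity>\<sigma>\<in>tree_vertices q. x \<sigma> * cnj (y \<sigma>))"

definition l2_norm :: "nat \<Rightarrow> (nat list \<Rightarrow> complex) \<Rightarrow> real" where
  "l2_norm q x = sqrt (\<Sum>\<^sub>\<infinity>\<sigma>\<in>tree_vertices q. (cmod (x \<sigma>))\<^sup>2)"

definition delta :: "nat list \<Rightarrow> nat list \<Rightarrow> complex" where
  "delta \<sigma> = (\<lambda>\<tau>. if \<tau> = \<sigma> then 1 else 0)"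

text \<open>
  Operators are total functions in HOL; only their values on \<open>l2 q\<close> are constrained
  here or used below.
\<close>

definition bounded_operator ::
    "nat \<Rightarrow> ((nat list \<Rightarrow> complex) \<Rightarrow> nat list \<Rightarrow> complex) \<Rightarrow> bool" where
  "bounded_operator q A \<longleftrightarrow>
     (\<forall>x\<in>l2 q. A x \<in> l2 q) \<and>
     (\<forall>x\<in>l2 q. \<forall>y\<in>l2 q. A (\<lambda>\<sigma>. x \<sigma> + y \<sigma>) = (\<lambda>\<sigma>. A x \<sigma> + A y \<sigma>)) \<and>
     (\<forall>c. \<forall>x\<in>l2 q. A (\<lambda>\<sigma>. c * x \<sigma>) = (\<lambda>\<sigma>. c * A x \<sigma>)) \<and>
     (\<exists>C. \<forall>x\<in>l2 q. l2_norm q (A x) \<le> C * l2_norm q x)"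

text \<open>As in \<^const>\<open>onorm\<close>, the zero vector contributes the quotient \<open>0 / 0 = 0\<close>.\<close>

definition operator_norm ::
    "nat \<Rightarrow> ((nat list \<Rightarrow> complex) \<Rightarrow> nat list \<Rightarrow> complex) \<Rightarrow> real" where
  "operator_norm q A = (SUP x\<in>l2 q. l2_norm q (A x) / l2_norm q x)"

definition operator_kernel ::
    "nat \<Rightarrow> ((nat list \<Rightarrow> complex) \<Rightarrow> nat list \<Rightarrow> complex) \<Rightarrow>
     nat list \<Rightarrow> nat list \<Rightarrow> complex" where
  "operator_kernel q A \<sigma> \<tau> =
     (if \<sigma> \<in> tree_vertices q \<and> \<tau> \<in> tree_vertices q
      then l2_inner q (A (delta \<tau>)) (delta \<sigma>) else 0)"

definition represents_bounded_operator ::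
    "nat \<Rightarrow> (nat list \<Rightarrow> nat list \<Rightarrow> complex) \<Rightarrow> bool" where
  "represents_bounded_operator q K \<longleftrightarrow> (\<exists>A. bounded_operator q A \<and> operator_kernel q A = K)"

definition B_Toep :: "nat \<Rightarrow> (nat list \<Rightarrow> nat list \<Rightarrow> complex) set" where
  "B_Toep q = {K \<in> Toep q. represents_bounded_operator q K}"


section \<open>Essentially bounded functions on the circle\<close>

text \<open>
  A function on the circle is a function \<open>f\<close> on the complex numbers, accessed only through
  \<open>\<theta> \<mapsto> f (cis \<theta>)\<close>; its values off the unit circle play no role. The measure
  is \<open>d\<theta> / (2 * pi)\<close> on the fundamental domain \<open>[0, 2 * pi)\<close>. Elements of
  \<open>Linf_circle\<close> are functions rather than classes modulo null sets; \<open>Linf_norm\<close> and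
  \<open>fourier_coeff\<close> depend only on the class.
\<close>

definition circle_measure :: "real measure" where
  "circle_measure = uniform_measure lebesgue {0..<2 * pi}"

definition circle_esssup :: "(complex \<Rightarrow> complex) \<Rightarrow> ereal" where
  "circle_esssup f = esssup circle_measure (\<lambda>\<theta>. ereal (cmod (f (cis \<theta>))))"

definition Linf_circle :: "(complex \<Rightarrow> complex) set" where
  "Linf_circle = {f. (\<lambda>\<theta>. f (cis \<theta>)) \<in> borel_measurable circle_measure \<and> circle_esssup f < \<infinity>}"

definition Linf_norm :: "(complex \<Rightarrow> complex) \<Rightarrow> real" where
  "Linf_norm f = real_of_ereal (circle_esssup f)"

definition fourier_coeff :: "(complex \<Rightarrow> complex) \<Rightarrow> int \<Rightarrow> complex" where
  "fourier_coeff f n = (LINT \<theta>|circle_measure. f (cis \<theta>) * cis (- (of_int n * \<theta>)))"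

end

theory Submission
  imports Defs "HOL-Library.Sublist" "HOL-Real_Asymp.Real_Asymp"
begin

text \<open>
  Let \<open>w\<close> run through the boundary of the tree and \<open>\<theta>\<close> through the circle. The functions
  \<open>q powr (length \<sigma> / 2) * indicator {w. prefix \<sigma> w} * cis (length \<sigma> * \<theta>)\<close> form an orthonormal system:
  vertices on one level have disjoint cylinders of measure \<open>q powr (- length \<sigma>)\<close>, and vertices on
  different levels carry different exponentials. The cylinders of \<open>\<sigma>\<close> and \<open>\<tau>\<close> meet exactly when the two
  vertices are comparable, and then the factors \<open>q powr (length \<sigma> / 2)\<close> leave precisely the weight
  \<open>q powr (- d / 2)\<close> of \<open>Gamma_kernel\<close>. Hence \<open>Gamma_kernel q (fourier_coeff f)\<close> is the compression
  of multiplication by \<open>f\<close> to the span of this system, which bounds its norm by \<open>Linf_norm f\<close>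
  (\<open>form_bound_Gamma\<close>). Only finitely many vertices occur at a time, so the words of one large
  length, with normalised counting measure, replace the boundary.

  Conversely, on radial vectors \<open>a (length \<sigma>) * q powr (- length \<sigma> / 2)\<close> the form of \<open>Gamma_kernel q c\<close>
  is the classical Toeplitz form with entries \<open>c (j - k)\<close> (\<open>form_bound_Gamma_imp_sections\<close>). If
  it is bounded by \<open>M\<close>, testing it on exponentials bounds all Fejer means of the series \<open>c\<close> by \<open>M\<close>.
  Their weights increase to 1 and their mean squares stay bounded, which makes them Cauchy in mean
  square; a subsequence converges almost
  everywhere, and its limit is a symbol with coefficients \<open>c\<close> bounded by \<open>M\<close>
  (\<open>bounded_toeplitz_sections_imp_symbol\<close>). Every branching-Toeplitz kernel is some
  \<open>Gamma_kernel q c\<close>, so this gives the description of \<open>B_Toep q\<close>. Taking for \<open>M\<close> the operator norm and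
  using that the coefficients determine the symbol (\<open>fourier_coeff_unique\<close>), it also gives
  \<open>Linf_norm f \<le> operator_norm q A\<close>.

  Boundedness is handled throughout through finite sections of the kernel (\<open>form_bound\<close>).
\<close>

section \<open>Comparability in the tree\<close>

text \<open>
  One step of a walk changes the length of the word by one; this is the lower bound for distances.
\<close>

lemma tree_walk_length:
  assumes "(\<sigma>, \<tau>) \<in> tree_edges q ^^ n"
  shows "length \<tau> \<le> length \<sigma> + n \<and> length \<sigma> \<le> length \<tau> + n"
  using assms
proof (induction n arbitrary: \<tau>)
  case (Suc n)
  then obtain \<rho> where \<rho>: "(\<sigma>, \<rho>) \<in> tree_edges q ^^ n" and e: "(\<rho>, \<tau>) \<in> tree_edges q"
    by auto
  from e have "length \<tau> \<le> Suc (length \<rho>) \<and> length \<rho> \<le> Suc (length \<tau>)"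
    by (auto simp: tree_edges_def)
  with Suc.IH[OF \<rho>] show ?case by auto
qed auto

lemma tree_walk_append:
  assumes "\<sigma> @ u \<in> tree_vertices q"
  shows "(\<sigma>, \<sigma> @ u) \<in> tree_edges q ^^ length u"
    and "(\<sigma> @ u, \<sigma>) \<in> tree_edges q ^^ length u"
proof -
  have "(\<sigma>, \<sigma> @ u) \<in> tree_edges q ^^ length u \<and> (\<sigma> @ u, \<sigma>) \<in> tree_edges q ^^ length u"
    using assms
  proof (induction u rule: rev_induct)
    case (snoc i u)
    have v: "\<sigma> @ u \<in> tree_vertices q"
      using snoc.prems by (auto simp: tree_vertices_def)
    have "(\<sigma> @ u, \<sigma> @ u @ [i]) \<in> tree_edges q" "(\<sigma> @ u @ [i], \<sigma> @ u) \<in> tree_edges q"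
      using v snoc.prems by (auto simp: tree_edges_def)
    with snoc.IH[OF v] show ?case
      by (auto intro: relpow_Suc_I relpow_Suc_I2 simp del: relpow.simps)
  qed auto
  then show "(\<sigma>, \<sigma> @ u) \<in> tree_edges q ^^ length u" "(\<sigma> @ u, \<sigma>) \<in> tree_edges q ^^ length u"
    by auto
qed

lemma tree_dist_append:
  assumes "\<sigma> @ u \<in> tree_vertices q"
  shows "tree_dist q \<sigma> (\<sigma> @ u) = length u" and "tree_dist q (\<sigma> @ u) \<sigma> = length u"
  unfolding tree_dist_def
  by (rule Least_equality; use tree_walk_append[OF assms] in \<open>force dest: tree_walk_length\<close>)+

lemma tree_level_eq_length: "\<sigma> \<in> tree_vertices q \<Longrightarrow> tree_level q \<sigma> = length \<sigma>"
  using tree_dist_append(1)[of "[]" \<sigma> q] by (simp add: tree_level_def)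

text \<open>
  \<open>tree_dist\<close> is a least element over walk lengths, so it means something only because any two
  vertices are joined by a walk, here the one through the root.
\<close>

lemma tree_walk_dist:
  assumes "\<sigma> \<in> tree_vertices q" "\<tau> \<in> tree_vertices q"
  shows "(\<sigma>, \<tau>) \<in> tree_edges q ^^ tree_dist q \<sigma> \<tau>"
proof -
  have "(\<sigma>, []) \<in> tree_edges q ^^ length \<sigma>" "([], \<tau>) \<in> tree_edges q ^^ length \<tau>"
    using tree_walk_append[of "[]"] assms by auto
  then have "(\<sigma>, \<tau>) \<in> tree_edges q ^^ (length \<sigma> + length \<tau>)"
    by (auto simp: relpow_add)
  then show ?thesis
    unfolding tree_dist_def by (rule LeastI)
qed

text \<open>
  The distance from the root forces \<open>r n\<close> to have length \<open>n\<close>; consecutive vertices of the ray are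
  adjacent, so each one appends a letter to the previous one.
\<close>

lemma geodesic_ray_prefix:
  assumes r: "geodesic_ray_from_root q r" and "m \<le> n"
  shows "prefix (r m) (r n)"
proof -
  have V: "r n \<in> tree_vertices q" for n
    using r by (auto simp: geodesic_ray_from_root_def)
  have len: "length (r n) = n" for n
  proof -
    have "tree_dist q (r 0) (r n) = n - 0" "r 0 = []"
      using r unfolding geodesic_ray_from_root_def by blast+
    then show ?thesis
      using tree_dist_append(1)[of "[]" "r n" q] V[of n] by simp
  qed
  have step: "prefix (r n) (r (Suc n))" for n
  proof -
    have "tree_dist q (r n) (r (Suc n)) = 1"
      using r by (auto simp: geodesic_ray_from_root_def)
    then have "(r n, r (Suc n)) \<in> tree_edges q"
      using tree_walk_dist[OF V V, of n "Suc n"] by simp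
    then show ?thesis
      using len[of n] len[of "Suc n"] by (auto simp: tree_edges_def)
  qed
  show ?thesis
    using \<open>m \<le> n\<close>
  proof (induction n rule: dec_induct)
    case (step n)
    then show ?case using \<open>\<And>n. prefix (r n) (r (Suc n))\<close> prefix_order.trans by blast
  qed auto
qed

text \<open>
  Every vertex lies on a ray, because it can be continued by the letter 0; here \<open>q > 0\<close> is essential.
\<close>

lemma geodesic_ray_through:
  assumes "q > 0" "\<tau> \<in> tree_vertices q"
  shows "geodesic_ray_from_root q (\<lambda>n. take n (\<tau> @ replicate n 0))"
    (is "geodesic_ray_from_root q ?r")
proof -
  have V: "?r n \<in> tree_vertices q" for n
    using assms by (auto simp: tree_vertices_def in_lists_conv_set dest!: in_set_takeD)
  have "tree_dist q (?r m) (?r n) = n - m" if "m \<le> n" for m n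
  proof -
    have "take m (?r n) = ?r m"
      using that by (simp add: min_def)
    then have "?r n = ?r m @ drop m (?r n)"
      using append_take_drop_id[of m "?r n"] by metis
    moreover have "length (drop m (?r n)) = n - m"
      by simp
    ultimately show ?thesis
      using tree_dist_append(1)[of "?r m" "drop m (?r n)" q] V[of n] by metis
  qed
  with V show ?thesis
    by (simp add: geodesic_ray_from_root_def)
qed

lemma tree_le_iff_prefix:
  assumes "q > 0" "\<sigma> \<in> tree_vertices q" "\<tau> \<in> tree_vertices q"
  shows "tree_le q \<sigma> \<tau> \<longleftrightarrow> prefix \<sigma> \<tau>"
proof
  assume "tree_le q \<sigma> \<tau>"
  then obtain r m n where r: "geodesic_ray_from_root q r" and "\<sigma> = r m" "\<tau> = r n"
    and len: "length \<sigma> \<le> length \<tau>"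
    using assms by (auto simp: tree_le_def tree_level_eq_length)
  then have "prefix \<sigma> \<tau> \<or> prefix \<tau> \<sigma>"
    using geodesic_ray_prefix[OF r] nat_le_linear by metis
  with len show "prefix \<sigma> \<tau>"
    by (metis le_antisym not_equal_is_parallel parallelE prefix_length_le prefix_order.order_refl)
next
  assume p: "prefix \<sigma> \<tau>"
  define r where "r = (\<lambda>n. take n (\<tau> @ replicate n 0))"
  have "\<tau> = r (length \<tau>)" "\<sigma> = r (length \<sigma>)"
    using p by (auto simp: r_def prefix_def)
  then have "\<tau> \<in> range r" "\<sigma> \<in> range r" by auto
  moreover have "geodesic_ray_from_root q r"
    unfolding r_def by (rule geodesic_ray_through[OF assms(1,3)])
  ultimately show "tree_le q \<sigma> \<tau>"
    using assms p by (auto simp: tree_le_def tree_level_eq_length prefix_length_le)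
qed

abbreviation comparable :: "nat list \<Rightarrow> nat list \<Rightarrow> bool" where
  "comparable \<sigma> \<tau> \<equiv> prefix \<sigma> \<tau> \<or> prefix \<tau> \<sigma>"

lemma comparable_pairs_iff:
  assumes "q > 0" "\<sigma> \<in> tree_vertices q" "\<tau> \<in> tree_vertices q"
  shows "(\<sigma>, \<tau>) \<in> comparable_pairs q \<longleftrightarrow> comparable \<sigma> \<tau>"
  using assms by (auto simp: comparable_pairs_def tree_le_iff_prefix)

lemma tree_dist_comparable:
  assumes "\<sigma> \<in> tree_vertices q" "\<tau> \<in> tree_vertices q" "comparable \<sigma> \<tau>"
  shows "int (tree_dist q \<sigma> \<tau>) = \<bar>int (length \<sigma>) - int (length \<tau>)\<bar>"
  using assms by (auto simp: prefix_def tree_dist_append)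

lemma Gamma_kernel_eq:
  assumes "q > 0" "\<sigma> \<in> tree_vertices q" "\<tau> \<in> tree_vertices q"
  shows "Gamma_kernel q c \<sigma> \<tau> =
    (if comparable \<sigma> \<tau>
     then of_real (real q powr (- \<bar>real (length \<sigma>) - real (length \<tau>)\<bar> / 2))
          * c (int (length \<sigma>) - int (length \<tau>))
     else 0)"
proof -
  have "real (tree_dist q \<sigma> \<tau>) = \<bar>real (length \<sigma>) - real (length \<tau>)\<bar>" if "comparable \<sigma> \<tau>"
    using arg_cong[OF tree_dist_comparable[OF assms(2,3) that], of real_of_int] by simp
  then show ?thesis
    using assms by (auto simp: Gamma_kernel_def tree_level_eq_length comparable_pairs_iff)
qed

lemma Gamma_kernel_outside:
  "\<sigma> \<notin> tree_vertices q \<or> \<tau> \<notin> tree_vertices q \<Longrightarrow> Gamma_kernel q c \<sigma> \<tau> = 0"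
  by (auto simp: Gamma_kernel_def comparable_pairs_def)

text \<open>
  On comparable pairs the distance is the difference of levels, so the weight of \<open>Gamma_kernel\<close> is a
  nonvanishing function of that difference and can be absorbed into the symbol.
\<close>

lemma Toep_eq_range_Gamma_kernel:
  assumes "q > 0"
  shows "Toep q = range (Gamma_kernel q)"
proof -
  define w :: "int \<Rightarrow> complex" where "w n = of_real (real q powr (- \<bar>real_of_int n\<bar> / 2))" for n
  have w: "w n \<noteq> 0" for n using assms by (simp add: w_def)
  have G: "Gamma_kernel q c = toeplitz_kernel q (\<lambda>n. w n * c n)" for c
  proof (intro ext)
    fix \<sigma> \<tau>
    show "Gamma_kernel q c \<sigma> \<tau> = toeplitz_kernel q (\<lambda>n. w n * c n) \<sigma> \<tau>"
    proof (cases "\<sigma> \<in> tree_vertices q \<and> \<tau> \<in> tree_vertices q")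
      case True
      then show ?thesis
        using assms
        by (auto simp: Gamma_kernel_eq toeplitz_kernel_def tree_level_eq_length w_def
            comparable_pairs_iff)
    next
      case False
      then show ?thesis
        by (auto simp: Gamma_kernel_def toeplitz_kernel_def comparable_pairs_def)
    qed
  qed
  have "toeplitz_kernel q \<alpha> = Gamma_kernel q (\<lambda>n. \<alpha> n / w n)" for \<alpha>
    unfolding G using w by simp
  then show ?thesis
    unfolding Toep_def using G by blast
qed

definition words :: "nat \<Rightarrow> nat \<Rightarrow> nat list set" where
  "words q n = {w \<in> tree_vertices q. length w = n}"

lemma words_eq: "words q n = {w. set w \<subseteq> {..<q} \<and> length w = n}"
  by (auto simp: words_def tree_vertices_def in_lists_conv_set)

lemma finite_words [simp]: "finite (words q n)"
  unfolding words_eq by (rule finite_lists_length_eq) simp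

lemma card_words: "card (words q n) = q ^ n"
  unfolding words_eq by (simp add: card_lists_length_eq)

lemma card_words_extending:
  assumes "\<sigma> \<in> tree_vertices q" "length \<sigma> \<le> n"
  shows "card {w \<in> words q n. prefix \<sigma> w} = q ^ (n - length \<sigma>)"
proof -
  have "{w \<in> words q n. prefix \<sigma> w} = (@) \<sigma> ` words q (n - length \<sigma>)"
  proof (intro equalityI subsetI)
    fix w assume "w \<in> {w \<in> words q n. prefix \<sigma> w}"
    then obtain u where "w = \<sigma> @ u" "\<sigma> @ u \<in> words q n"
      by (auto simp: prefix_def)
    then show "w \<in> (@) \<sigma> ` words q (n - length \<sigma>)"
      by (auto simp: words_eq)
  qed (use assms in \<open>auto simp: words_def tree_vertices_def\<close>)
  then show ?thesis
    by (simp add: card_image inj_on_def card_words)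
qed

text \<open>
  The measure of the intersection of two cylinders, counted at level \<open>n\<close>.
\<close>

lemma card_words_extending_both:
  assumes "\<sigma> \<in> tree_vertices q" "\<tau> \<in> tree_vertices q" "length \<sigma> \<le> n" "length \<tau> \<le> n"
  shows "card {w \<in> words q n. prefix \<sigma> w \<and> prefix \<tau> w} =
    (if comparable \<sigma> \<tau> then q ^ (n - max (length \<sigma>) (length \<tau>)) else 0)"
proof -
  consider "prefix \<sigma> \<tau>" | "prefix \<tau> \<sigma>" | "\<not> comparable \<sigma> \<tau>" by blast
  then show ?thesis
  proof cases
    case 1
    then have "{w \<in> words q n. prefix \<sigma> w \<and> prefix \<tau> w} = {w \<in> words q n. prefix \<tau> w}"
      using prefix_order.trans by blast
    with 1 show ?thesis
      using card_words_extending[OF assms(2,4)] prefix_length_le[OF 1] by (simp add: max_def)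
  next
    case 2
    then have "{w \<in> words q n. prefix \<sigma> w \<and> prefix \<tau> w} = {w \<in> words q n. prefix \<sigma> w}"
      using prefix_order.trans by blast
    with 2 show ?thesis
      using card_words_extending[OF assms(1,3)] prefix_length_le[OF 2] by (simp add: max_def)
  next
    case 3
    then have "{w \<in> words q n. prefix \<sigma> w \<and> prefix \<tau> w} = {}"
      using prefix_same_cases by blast
    with 3 show ?thesis by simp
  qed
qed

section \<open>Kernels of bounded operators and their finite sections\<close>

text \<open>
  The quadratic mean on the right replaces the product of the two norms. Rescaling \<open>x\<close> and \<open>y\<close> in
  opposite directions shows that both versions say the same, and this one is additive in the two
  vectors, so it can be integrated.
\<close>

definition form_bound :: "nat \<Rightarrow> (nat list \<Rightarrow> nat list \<Rightarrow> complex) \<Rightarrow> real \<Rightarrow> bool" where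
  "form_bound q K C \<longleftrightarrow> 0 \<le> C \<and>
     (\<forall>F x y. finite F \<and> F \<subseteq> tree_vertices q \<longrightarrow>
        cmod (\<Sum>\<sigma>\<in>F. \<Sum>\<tau>\<in>F. K \<sigma> \<tau> * x \<tau> * cnj (y \<sigma>))
          \<le> C * ((\<Sum>\<sigma>\<in>F. (cmod (x \<sigma>))\<^sup>2) + (\<Sum>\<sigma>\<in>F. (cmod (y \<sigma>))\<^sup>2)) / 2)"

lemma form_boundD:
  assumes "form_bound q K C" "finite F" "F \<subseteq> tree_vertices q"
  shows "cmod (\<Sum>\<sigma>\<in>F. \<Sum>\<tau>\<in>F. K \<sigma> \<tau> * x \<tau> * cnj (y \<sigma>))
          \<le> C * ((\<Sum>\<sigma>\<in>F. (cmod (x \<sigma>))\<^sup>2) + (\<Sum>\<sigma>\<in>F. (cmod (y \<sigma>))\<^sup>2)) / 2"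
  using assms unfolding form_bound_def by blast

text \<open>
  The scaling \<open>t = 1 / C\<close> is the optimal one; it turns the additive bound into the
  multiplicative one.
\<close>

lemma le_square_of_scaling:
  fixes S X C :: real
  assumes "\<And>t. t \<ge> 0 \<Longrightarrow> t * S \<le> C * (X + t\<^sup>2 * S) / 2" and "C \<ge> 0"
  shows "S \<le> C\<^sup>2 * X"
proof (cases "C = 0")
  case True
  then show ?thesis using assms(1)[of 1] by simp
next
  case False
  with \<open>C \<ge> 0\<close> have C: "C > 0" by simp
  from assms(1)[of "1 / C"] C have "S / C \<le> C * X / 2 + S / C / 2"
    by (simp add: field_simps power2_eq_square)
  then have "S / C \<le> C * X" by simp
  with C show ?thesis by (simp add: field_simps power2_eq_square)
qed

text \<open>
  Test the form against \<open>y = t * K x\<close> and optimise over \<open>t\<close>.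
\<close>

lemma form_bound_section:
  assumes K: "form_bound q K C"
    and F: "finite F" "F \<subseteq> tree_vertices q" and G: "finite G" "G \<subseteq> tree_vertices q"
  shows "(\<Sum>\<sigma>\<in>G. (cmod (\<Sum>\<tau>\<in>F. K \<sigma> \<tau> * x \<tau>))\<^sup>2) \<le> C\<^sup>2 * (\<Sum>\<tau>\<in>F. (cmod (x \<tau>))\<^sup>2)"
proof (rule le_square_of_scaling)
  show "C \<ge> 0" using K by (simp add: form_bound_def)
  define v where "v \<sigma> = (\<Sum>\<tau>\<in>F. K \<sigma> \<tau> * x \<tau>)" for \<sigma>
  fix t :: real assume "t \<ge> 0"
  define S where "S = (\<Sum>\<sigma>\<in>G. (cmod (v \<sigma>))\<^sup>2)"
  define x' where "x' \<sigma> = (if \<sigma> \<in> F then x \<sigma> else 0)" for \<sigma>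
  define y' where "y' \<sigma> = (if \<sigma> \<in> G then of_real t * v \<sigma> else 0)" for \<sigma>
  have H: "finite (F \<union> G)" "F \<union> G \<subseteq> tree_vertices q" using F G by auto
  have "(\<Sum>\<sigma>\<in>F \<union> G. \<Sum>\<tau>\<in>F \<union> G. K \<sigma> \<tau> * x' \<tau> * cnj (y' \<sigma>))
      = (\<Sum>\<sigma>\<in>F \<union> G. v \<sigma> * cnj (y' \<sigma>))"
  proof (rule sum.cong[OF refl])
    fix \<sigma>
    have "(\<Sum>\<tau>\<in>F \<union> G. K \<sigma> \<tau> * x' \<tau> * cnj (y' \<sigma>)) = (\<Sum>\<tau>\<in>F. K \<sigma> \<tau> * x' \<tau> * cnj (y' \<sigma>))"
      using H by (intro sum.mono_neutral_right) (auto simp: x'_def)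
    also have "\<dots> = v \<sigma> * cnj (y' \<sigma>)"
      by (simp add: v_def x'_def sum_distrib_right)
    finally show "(\<Sum>\<tau>\<in>F \<union> G. K \<sigma> \<tau> * x' \<tau> * cnj (y' \<sigma>)) = v \<sigma> * cnj (y' \<sigma>)" .
  qed
  also have "\<dots> = (\<Sum>\<sigma>\<in>G. v \<sigma> * cnj (y' \<sigma>))"
    using H by (intro sum.mono_neutral_right) (auto simp: y'_def)
  also have "\<dots> = of_real (t * S)"
    by (simp add: y'_def S_def sum_distrib_left mult.left_commute
        flip: complex_norm_square of_real_power)
  finally have 1: "(\<Sum>\<sigma>\<in>F \<union> G. \<Sum>\<tau>\<in>F \<union> G. K \<sigma> \<tau> * x' \<tau> * cnj (y' \<sigma>)) = of_real (t * S)" .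
  have 2: "(\<Sum>\<sigma>\<in>F \<union> G. (cmod (x' \<sigma>))\<^sup>2) = (\<Sum>\<sigma>\<in>F. (cmod (x \<sigma>))\<^sup>2)"
    using H by (intro sum.mono_neutral_cong_right) (auto simp: x'_def)
  have "(\<Sum>\<sigma>\<in>F \<union> G. (cmod (y' \<sigma>))\<^sup>2) = (\<Sum>\<sigma>\<in>G. t\<^sup>2 * (cmod (v \<sigma>))\<^sup>2)"
    using H by (intro sum.mono_neutral_cong_right) (auto simp: y'_def norm_mult power_mult_distrib)
  then have 3: "(\<Sum>\<sigma>\<in>F \<union> G. (cmod (y' \<sigma>))\<^sup>2) = t\<^sup>2 * S"
    by (simp add: S_def sum_distrib_left)
  have "\<bar>t * S\<bar> \<le> C * ((\<Sum>\<sigma>\<in>F. (cmod (x \<sigma>))\<^sup>2) + t\<^sup>2 * S) / 2"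
    using form_boundD[OF K H, of x' y'] unfolding 1 2 3 norm_of_real .
  then show "t * (\<Sum>\<sigma>\<in>G. (cmod (\<Sum>\<tau>\<in>F. K \<sigma> \<tau> * x \<tau>))\<^sup>2)
      \<le> C * ((\<Sum>\<tau>\<in>F. (cmod (x \<tau>))\<^sup>2) + t\<^sup>2 * (\<Sum>\<sigma>\<in>G. (cmod (\<Sum>\<tau>\<in>F. K \<sigma> \<tau> * x \<tau>))\<^sup>2)) / 2"
    by (simp add: S_def v_def)
qed

abbreviation restrict_to :: "nat list set \<Rightarrow> (nat list \<Rightarrow> complex) \<Rightarrow> nat list \<Rightarrow> complex" where
  "restrict_to F x \<equiv> \<lambda>\<sigma>. if \<sigma> \<in> F then x \<sigma> else 0"

lemma l2_norm_nonneg: "l2_norm q x \<ge> 0"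
  by (simp add: l2_norm_def infsum_nonneg)

lemma l2_norm_square: "(l2_norm q x)\<^sup>2 = (\<Sum>\<^sub>\<infinity>\<sigma>\<in>tree_vertices q. (cmod (x \<sigma>))\<^sup>2)"
  by (simp add: l2_norm_def infsum_nonneg)

lemma sum_le_l2_norm_square:
  assumes "x \<in> l2 q" "finite F" "F \<subseteq> tree_vertices q"
  shows "(\<Sum>\<sigma>\<in>F. (cmod (x \<sigma>))\<^sup>2) \<le> (l2_norm q x)\<^sup>2"
  unfolding l2_norm_square using assms by (intro finite_sum_le_infsum) (auto simp: l2_def)

lemma cmod_le_l2_norm:
  assumes "x \<in> l2 q"
  shows "cmod (x \<sigma>) \<le> l2_norm q x"
proof (cases "\<sigma> \<in> tree_vertices q")
  case True
  then show ?thesis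
    using sum_le_l2_norm_square[OF assms, of "{\<sigma>}"] l2_norm_nonneg[of q x]
    by (simp add: power2_le_iff_abs_le)
next
  case False
  then show ?thesis
    using assms l2_norm_nonneg[of q x] by (simp add: l2_def)
qed

lemma restrict_to_finite:
  assumes "finite F" "F \<subseteq> tree_vertices q"
  shows "restrict_to F x \<in> l2 q" and "(l2_norm q (restrict_to F x))\<^sup>2 = (\<Sum>\<sigma>\<in>F. (cmod (x \<sigma>))\<^sup>2)"
proof -
  have "((\<lambda>\<sigma>. (cmod (restrict_to F x \<sigma>))\<^sup>2) has_sum (\<Sum>\<sigma>\<in>F. (cmod (x \<sigma>))\<^sup>2)) (tree_vertices q)"
    by (rule has_sum_finite_neutralI) (use assms in auto)
  then show "restrict_to F x \<in> l2 q" "(l2_norm q (restrict_to F x))\<^sup>2 = (\<Sum>\<sigma>\<in>F. (cmod (x \<sigma>))\<^sup>2)"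
    using assms by (auto simp: l2_def l2_norm_square summable_on_def infsumI)
qed

lemma delta_eq_restrict: "delta \<tau> = restrict_to {\<tau>} (\<lambda>_. 1)"
  by (auto simp: delta_def)

lemma l2_inner_delta:
  assumes "\<sigma> \<in> tree_vertices q"
  shows "l2_inner q x (delta \<sigma>) = x \<sigma>"
proof -
  have "((\<lambda>\<tau>. x \<tau> * cnj (delta \<sigma> \<tau>)) has_sum (\<Sum>\<tau>\<in>{\<sigma>}. x \<tau>)) (tree_vertices q)"
    by (rule has_sum_finite_neutralI[of "{\<sigma>}"]) (use assms in \<open>auto simp: delta_def\<close>)
  then show ?thesis by (simp add: l2_inner_def infsumI)
qed

lemma l2_lincomb:
  assumes "x \<in> l2 q" "y \<in> l2 q"
  shows "(\<lambda>\<sigma>. c * x \<sigma>) \<in> l2 q" "(\<lambda>\<sigma>. x \<sigma> + y \<sigma>) \<in> l2 q"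
proof -
  have x: "(\<lambda>\<sigma>. (cmod (x \<sigma>))\<^sup>2) summable_on tree_vertices q"
    and y: "(\<lambda>\<sigma>. (cmod (y \<sigma>))\<^sup>2) summable_on tree_vertices q"
    using assms by (auto simp: l2_def)
  show "(\<lambda>\<sigma>. c * x \<sigma>) \<in> l2 q"
    using assms summable_on_cmult_right[OF x, of "(cmod c)\<^sup>2"]
    by (auto simp: l2_def norm_mult power_mult_distrib)
  have "(\<lambda>\<sigma>. 2 * (cmod (x \<sigma>))\<^sup>2 + 2 * (cmod (y \<sigma>))\<^sup>2) summable_on tree_vertices q"
    by (intro summable_on_add summable_on_cmult_right x y)
  moreover have "(cmod (x \<sigma> + y \<sigma>))\<^sup>2 \<le> 2 * (cmod (x \<sigma>))\<^sup>2 + 2 * (cmod (y \<sigma>))\<^sup>2" for \<sigma>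
  proof -
    have "(cmod (x \<sigma> + y \<sigma>))\<^sup>2 \<le> (cmod (x \<sigma>) + cmod (y \<sigma>))\<^sup>2"
      by (intro power_mono norm_triangle_ineq) auto
    also have "\<dots> \<le> 2 * (cmod (x \<sigma>))\<^sup>2 + 2 * (cmod (y \<sigma>))\<^sup>2"
      using sum_squares_bound[of "cmod (x \<sigma>)" "cmod (y \<sigma>)"] by (simp add: power2_sum)
    finally show ?thesis .
  qed
  ultimately have "(\<lambda>\<sigma>. (cmod (x \<sigma> + y \<sigma>))\<^sup>2) summable_on tree_vertices q"
    by (rule summable_on_comparison_test) auto
  then show "(\<lambda>\<sigma>. x \<sigma> + y \<sigma>) \<in> l2 q"
    using assms by (auto simp: l2_def)
qed

lemma
  assumes "bounded_operator q A" "x \<in> l2 q"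
  shows bounded_operator_add: "y \<in> l2 q \<Longrightarrow> A (\<lambda>\<sigma>. x \<sigma> + y \<sigma>) = (\<lambda>\<sigma>. A x \<sigma> + A y \<sigma>)"
    and bounded_operator_scale: "A (\<lambda>\<sigma>. c * x \<sigma>) = (\<lambda>\<sigma>. c * A x \<sigma>)"
  using assms by (simp_all add: bounded_operator_def)

text \<open>
  By linearity an operator is determined on finitely supported vectors by its kernel.
\<close>

lemma bounded_operator_finite_support:
  assumes A: "bounded_operator q A" and F: "finite F" "F \<subseteq> tree_vertices q"
  shows "A (restrict_to F x) = (\<lambda>\<sigma>. \<Sum>\<tau>\<in>F. operator_kernel q A \<sigma> \<tau> * x \<tau>)"
  using F
proof (induction F rule: finite_induct)
  case empty
  have "A (\<lambda>\<sigma>. 0 * (restrict_to {} x) \<sigma>) = (\<lambda>\<sigma>. 0 * A (restrict_to {} x) \<sigma>)"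
    by (rule bounded_operator_scale[OF A restrict_to_finite(1)]) auto
  then show ?case by simp
next
  case (insert \<tau> F)
  have \<tau>: "\<tau> \<in> tree_vertices q" and F: "F \<subseteq> tree_vertices q" using insert.prems by auto
  have d: "delta \<tau> \<in> l2 q"
    unfolding delta_eq_restrict using \<tau> by (intro restrict_to_finite) auto
  have Ad: "A (delta \<tau>) \<sigma> = operator_kernel q A \<sigma> \<tau>" for \<sigma>
  proof -
    have "A (delta \<tau>) \<in> l2 q" using A d by (auto simp: bounded_operator_def)
    then show ?thesis
      using \<tau> by (auto simp: operator_kernel_def l2_inner_delta l2_def)
  qed
  have r: "restrict_to F x \<in> l2 q"
    using insert F by (intro restrict_to_finite)
  have "restrict_to (insert \<tau> F) x = (\<lambda>\<sigma>. x \<tau> * delta \<tau> \<sigma> + restrict_to F x \<sigma>)"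
    using insert by (auto simp: delta_def)
  then have "A (restrict_to (insert \<tau> F) x) = (\<lambda>\<sigma>. A (\<lambda>\<sigma>. x \<tau> * delta \<tau> \<sigma>) \<sigma> + A (restrict_to F x) \<sigma>)"
    using A l2_lincomb(1)[OF d d] r by (simp add: bounded_operator_def)
  also have "\<dots> = (\<lambda>\<sigma>. x \<tau> * A (delta \<tau>) \<sigma> + A (restrict_to F x) \<sigma>)"
    using A d by (simp add: bounded_operator_def)
  finally show ?case
    using insert F by (simp add: Ad mult.commute)
qed

lemma form_bound_operator_kernel:
  assumes A: "bounded_operator q A" and "C \<ge> 0"
    and bound: "\<And>x. x \<in> l2 q \<Longrightarrow> l2_norm q (A x) \<le> C * l2_norm q x"
  shows "form_bound q (operator_kernel q A) C"
  unfolding form_bound_def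
proof (intro conjI allI impI, fact, elim conjE)
  fix F x y assume F: "finite F" "F \<subseteq> tree_vertices q"
  define u where "u = A (restrict_to F x)"
  define X where "X = (\<Sum>\<sigma>\<in>F. (cmod (x \<sigma>))\<^sup>2)"
  define Y where "Y = (\<Sum>\<sigma>\<in>F. (cmod (y \<sigma>))\<^sup>2)"
  have r: "restrict_to F x \<in> l2 q" using F by (rule restrict_to_finite)
  have u: "u \<in> l2 q" using A r by (simp add: u_def bounded_operator_def)
  have "(\<Sum>\<sigma>\<in>F. (cmod (u \<sigma>))\<^sup>2) \<le> (l2_norm q u)\<^sup>2"
    by (rule sum_le_l2_norm_square[OF u F])
  also have "\<dots> \<le> (C * l2_norm q (restrict_to F x))\<^sup>2"
    using bound[OF r] l2_norm_nonneg by (intro power_mono) (auto simp: u_def)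
  also have "\<dots> = C\<^sup>2 * X"
    using restrict_to_finite(2)[OF F, of x] by (simp add: power_mult_distrib X_def)
  finally have U: "(\<Sum>\<sigma>\<in>F. (cmod (u \<sigma>))\<^sup>2) \<le> C\<^sup>2 * X" .
  have X: "X \<ge> 0" and Y: "Y \<ge> 0" by (simp_all add: X_def Y_def sum_nonneg)
  have "(\<Sum>\<sigma>\<in>F. \<Sum>\<tau>\<in>F. operator_kernel q A \<sigma> \<tau> * x \<tau> * cnj (y \<sigma>)) = (\<Sum>\<sigma>\<in>F. u \<sigma> * cnj (y \<sigma>))"
    unfolding u_def bounded_operator_finite_support[OF A F] by (simp add: sum_distrib_right)
  also have "cmod \<dots> \<le> (\<Sum>\<sigma>\<in>F. \<bar>cmod (u \<sigma>)\<bar> * \<bar>cmod (y \<sigma>)\<bar>)"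
    by (rule order_trans[OF norm_sum]) (simp add: norm_mult)
  also have "\<dots> \<le> sqrt (\<Sum>\<sigma>\<in>F. (cmod (u \<sigma>))\<^sup>2) * sqrt Y"
    using L2_set_mult_ineq[of "\<lambda>\<sigma>. cmod (u \<sigma>)" "\<lambda>\<sigma>. cmod (y \<sigma>)" F] by (simp add: L2_set_def Y_def)
  also have "\<dots> \<le> sqrt (C\<^sup>2 * X) * sqrt Y"
    using U Y by (intro mult_right_mono real_sqrt_le_mono) auto
  also have "\<dots> = C * sqrt (X * Y)"
    using \<open>C \<ge> 0\<close> by (simp add: real_sqrt_mult)
  also have "\<dots> \<le> C * ((X + Y) / 2)"
    using \<open>C \<ge> 0\<close> arith_geo_mean_sqrt[OF X Y] by (intro mult_left_mono)
  finally show "cmod (\<Sum>\<sigma>\<in>F. \<Sum>\<tau>\<in>F. operator_kernel q A \<sigma> \<tau> * x \<tau> * cnj (y \<sigma>))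
      \<le> C * ((\<Sum>\<sigma>\<in>F. (cmod (x \<sigma>))\<^sup>2) + (\<Sum>\<sigma>\<in>F. (cmod (y \<sigma>))\<^sup>2)) / 2"
    by (simp add: X_def Y_def)
qed

lemma l2I_norm_le:
  assumes "\<And>\<sigma>. \<sigma> \<notin> tree_vertices q \<Longrightarrow> z \<sigma> = 0" and "B \<ge> 0"
    and bound: "\<And>G. finite G \<Longrightarrow> G \<subseteq> tree_vertices q \<Longrightarrow> (\<Sum>\<sigma>\<in>G. (cmod (z \<sigma>))\<^sup>2) \<le> B\<^sup>2"
  shows "z \<in> l2 q" and "l2_norm q z \<le> B"
proof -
  have s: "(\<lambda>\<sigma>. (cmod (z \<sigma>))\<^sup>2) summable_on tree_vertices q"
    by (rule nonneg_bdd_above_summable_on) (use bound in \<open>auto simp: bdd_above_def\<close>)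
  then show "z \<in> l2 q" using assms by (simp add: l2_def)
  have "(l2_norm q z)\<^sup>2 \<le> B\<^sup>2"
    unfolding l2_norm_square using s bound by (intro infsum_le_finite_sums)
  then show "l2_norm q z \<le> B" using \<open>B \<ge> 0\<close> by (rule power2_le_imp_le)
qed

text \<open>
  Finitely supported vectors are dense; the factor \<open>-1\<close> keeps the difference in the shape in which
  \<open>bounded_operator\<close> states linearity.
\<close>

lemma tendsto_l2_norm_tail:
  assumes "x \<in> l2 q"
  shows "((\<lambda>F. l2_norm q (\<lambda>\<sigma>. x \<sigma> + (-1) * restrict_to F x \<sigma>)) \<longlongrightarrow> 0)
    (finite_subsets_at_top (tree_vertices q))"
proof -
  let ?V = "tree_vertices q" and ?p = "\<lambda>\<sigma>. (cmod (x \<sigma>))\<^sup>2"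
  have s: "?p summable_on ?V" using assms by (simp add: l2_def)
  then have "(?p has_sum infsum ?p ?V) ?V" by simp
  then have "(sum ?p \<longlongrightarrow> infsum ?p ?V) (finite_subsets_at_top ?V)" by (simp add: has_sum_def)
  then have "((\<lambda>F. sqrt (infsum ?p ?V - sum ?p F)) \<longlongrightarrow> sqrt (infsum ?p ?V - infsum ?p ?V))
      (finite_subsets_at_top ?V)"
    by (intro tendsto_intros)
  moreover have "\<forall>\<^sub>F F in finite_subsets_at_top ?V.
      sqrt (infsum ?p ?V - sum ?p F) = l2_norm q (\<lambda>\<sigma>. x \<sigma> + (-1) * restrict_to F x \<sigma>)"
  proof (rule eventually_finite_subsets_at_top_weakI)
    fix F assume F: "finite F" "F \<subseteq> ?V"
    have "infsum (\<lambda>\<sigma>. (cmod (x \<sigma> + (-1) * restrict_to F x \<sigma>))\<^sup>2) ?V = infsum ?p (?V - F)"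
      by (rule infsum_cong_neutral) auto
    also have "\<dots> = infsum ?p ?V - sum ?p F"
      using infsum_Diff[OF s, of F] F by simp
    finally show "sqrt (infsum ?p ?V - sum ?p F) = l2_norm q (\<lambda>\<sigma>. x \<sigma> + (-1) * restrict_to F x \<sigma>)"
      by (simp add: l2_norm_def)
  qed
  ultimately show ?thesis
    by (simp add: filterlim_cong[OF refl refl])
qed

text \<open>
  Finite sections of the kernel control the operator on finitely supported vectors. Convergence
  \<open>A (restrict_to F x) \<longlonglongrightarrow> A x\<close> at each vertex carries the bound on each finite set of vertices over
  to \<open>A x\<close>.
\<close>

lemma l2_norm_le_form_bound:
  assumes A: "bounded_operator q A" and K: "form_bound q (operator_kernel q A) C" and x: "x \<in> l2 q"
  shows "l2_norm q (A x) \<le> C * l2_norm q x"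
proof (rule l2I_norm_le(2))
  let ?V = "tree_vertices q"
  have C: "C \<ge> 0" using K by (simp add: form_bound_def)
  then show "C * l2_norm q x \<ge> 0" by (simp add: l2_norm_nonneg)
  have "A x \<in> l2 q" using A x by (simp add: bounded_operator_def)
  then show "\<And>\<sigma>. \<sigma> \<notin> ?V \<Longrightarrow> A x \<sigma> = 0" by (simp add: l2_def)
  obtain B where B: "\<And>x. x \<in> l2 q \<Longrightarrow> l2_norm q (A x) \<le> B * l2_norm q x"
    using A unfolding bounded_operator_def by blast
  (* Continuity of A comes from its own constant B; the bound by C is recovered in the limit. *)
  have lim: "((\<lambda>F. A (restrict_to F x) \<sigma>) \<longlongrightarrow> A x \<sigma>) (finite_subsets_at_top ?V)" for \<sigma>
  proof -
    have "((\<lambda>F. A x \<sigma> - A (restrict_to F x) \<sigma>) \<longlongrightarrow> 0) (finite_subsets_at_top ?V)"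
    proof (rule Lim_null_comparison)
      show "((\<lambda>F. B * l2_norm q (\<lambda>\<sigma>. x \<sigma> + (-1) * restrict_to F x \<sigma>)) \<longlongrightarrow> 0)
          (finite_subsets_at_top ?V)"
        using tendsto_mult_left[OF tendsto_l2_norm_tail[OF x], of B] by simp
      show "\<forall>\<^sub>F F in finite_subsets_at_top ?V. cmod (A x \<sigma> - A (restrict_to F x) \<sigma>)
          \<le> B * l2_norm q (\<lambda>\<sigma>. x \<sigma> + (-1) * restrict_to F x \<sigma>)"
      proof (rule eventually_finite_subsets_at_top_weakI)
        fix F assume F: "finite F" "F \<subseteq> ?V"
        let ?r = "restrict_to F x"
        have r: "?r \<in> l2 q" using F by (rule restrict_to_finite)
        have m: "(\<lambda>\<sigma>. (-1) * ?r \<sigma>) \<in> l2 q" by (rule l2_lincomb(1)[OF r r])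
        have d: "(\<lambda>\<sigma>. x \<sigma> + (-1) * ?r \<sigma>) \<in> l2 q" by (rule l2_lincomb(2)[OF x m])
        have "A (\<lambda>\<sigma>. x \<sigma> + (-1) * ?r \<sigma>) = (\<lambda>\<sigma>. A x \<sigma> + A (\<lambda>\<sigma>. (-1) * ?r \<sigma>) \<sigma>)"
          by (rule bounded_operator_add[OF A x m])
        moreover have "A (\<lambda>\<sigma>. (-1) * ?r \<sigma>) = (\<lambda>\<sigma>. (-1) * A ?r \<sigma>)"
          by (rule bounded_operator_scale[OF A r])
        ultimately have "A x \<sigma> - A ?r \<sigma> = A (\<lambda>\<sigma>. x \<sigma> + (-1) * ?r \<sigma>) \<sigma>" by simp
        also have "cmod \<dots> \<le> l2_norm q (A (\<lambda>\<sigma>. x \<sigma> + (-1) * ?r \<sigma>))"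
          using A d by (intro cmod_le_l2_norm) (simp add: bounded_operator_def)
        also have "\<dots> \<le> B * l2_norm q (\<lambda>\<sigma>. x \<sigma> + (-1) * ?r \<sigma>)"
          by (rule B[OF d])
        finally show "cmod (A x \<sigma> - A ?r \<sigma>) \<le> B * l2_norm q (\<lambda>\<sigma>. x \<sigma> + (-1) * ?r \<sigma>)" .
      qed
    qed
    from tendsto_diff[OF tendsto_const[of "A x \<sigma>"] this] show ?thesis by simp
  qed
  fix G assume G: "finite G" "G \<subseteq> ?V"
  show "(\<Sum>\<sigma>\<in>G. (cmod (A x \<sigma>))\<^sup>2) \<le> (C * l2_norm q x)\<^sup>2"
  proof (rule tendsto_upperbound)
    show "((\<lambda>F. \<Sum>\<sigma>\<in>G. (cmod (A (restrict_to F x) \<sigma>))\<^sup>2) \<longlongrightarrow> (\<Sum>\<sigma>\<in>G. (cmod (A x \<sigma>))\<^sup>2))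
        (finite_subsets_at_top ?V)"
      by (intro tendsto_intros lim)
    show "\<forall>\<^sub>F F in finite_subsets_at_top ?V.
        (\<Sum>\<sigma>\<in>G. (cmod (A (restrict_to F x) \<sigma>))\<^sup>2) \<le> (C * l2_norm q x)\<^sup>2"
    proof (rule eventually_finite_subsets_at_top_weakI)
      fix F assume F: "finite F" "F \<subseteq> ?V"
      have "(\<Sum>\<sigma>\<in>G. (cmod (A (restrict_to F x) \<sigma>))\<^sup>2) \<le> C\<^sup>2 * (\<Sum>\<tau>\<in>F. (cmod (x \<tau>))\<^sup>2)"
        unfolding bounded_operator_finite_support[OF A F] by (rule form_bound_section[OF K F G])
      also have "\<dots> \<le> C\<^sup>2 * (l2_norm q x)\<^sup>2"
        by (intro mult_left_mono sum_le_l2_norm_square x F) auto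
      finally show "(\<Sum>\<sigma>\<in>G. (cmod (A (restrict_to F x) \<sigma>))\<^sup>2) \<le> (C * l2_norm q x)\<^sup>2"
        by (simp add: power_mult_distrib)
    qed
  qed simp
qed

text \<open>
  The bound applied to a single row makes the rows square summable, so that the matrix can be
  applied to every square-summable vector.
\<close>

lemma form_bound_imp_represents:
  assumes K: "form_bound q K C"
    and outside: "\<And>\<sigma> \<tau>. \<sigma> \<notin> tree_vertices q \<or> \<tau> \<notin> tree_vertices q \<Longrightarrow> K \<sigma> \<tau> = 0"
  shows "represents_bounded_operator q K"
proof -
  let ?V = "tree_vertices q"
  define A where "A x = (\<lambda>\<sigma>. \<Sum>\<^sub>\<infinity>\<tau>\<in>?V. K \<sigma> \<tau> * x \<tau>)" for x :: "nat list \<Rightarrow> complex"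
  have C: "C \<ge> 0" using K by (simp add: form_bound_def)
  have row: "(\<lambda>\<tau>. (cmod (K \<sigma> \<tau>))\<^sup>2) summable_on ?V" if \<sigma>: "\<sigma> \<in> ?V" for \<sigma>
  proof (rule nonneg_bdd_above_summable_on)
    have "(\<Sum>\<tau>\<in>F. (cmod (K \<sigma> \<tau>))\<^sup>2) \<le> C\<^sup>2" if F: "F \<subseteq> ?V" "finite F" for F
    proof -
      define s where "s = (\<Sum>\<tau>\<in>F. (cmod (K \<sigma> \<tau>))\<^sup>2)"
      have "(\<Sum>\<tau>\<in>F. K \<sigma> \<tau> * cnj (K \<sigma> \<tau>)) = of_real s"
        by (simp add: s_def flip: complex_norm_square of_real_power)
      then have "s\<^sup>2 \<le> C\<^sup>2 * s"
        using form_bound_section[OF K F(2,1), of "{\<sigma>}" "\<lambda>\<tau>. cnj (K \<sigma> \<tau>)"] \<sigma>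
        unfolding s_def[symmetric] by (simp add: s_def[symmetric])
      moreover have "s \<ge> 0" by (simp add: s_def sum_nonneg)
      ultimately have "s \<le> C\<^sup>2"
        by (cases "s = 0") (auto simp: power2_eq_square)
      then show ?thesis by (simp add: s_def)
    qed
    then show "bdd_above (sum (\<lambda>\<tau>. (cmod (K \<sigma> \<tau>))\<^sup>2) ` {F. F \<subseteq> ?V \<and> finite F})"
      by (auto simp: bdd_above_def)
  qed auto
  have summ: "(\<lambda>\<tau>. K \<sigma> \<tau> * x \<tau>) summable_on ?V" if x: "x \<in> l2 q" for x \<sigma>
  proof (cases "\<sigma> \<in> ?V")
    case True
    have "(\<lambda>\<tau>. (cmod (K \<sigma> \<tau>))\<^sup>2 + (cmod (x \<tau>))\<^sup>2) summable_on ?V"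
      using row[OF True] x by (intro summable_on_add) (auto simp: l2_def)
    then have "(\<lambda>\<tau>. norm (K \<sigma> \<tau> * x \<tau>)) summable_on ?V"
    proof (rule summable_on_comparison_test)
      fix \<tau>
      show "norm (K \<sigma> \<tau> * x \<tau>) \<le> (cmod (K \<sigma> \<tau>))\<^sup>2 + (cmod (x \<tau>))\<^sup>2"
      proof -
        have "0 \<le> cmod (K \<sigma> \<tau>) * cmod (x \<tau>)" by simp
        then show ?thesis
          using sum_squares_bound[of "cmod (K \<sigma> \<tau>)" "cmod (x \<tau>)"]
          unfolding norm_mult by linarith
      qed
    qed auto
    then show ?thesis by (rule abs_summable_summable)
  next
    case False
    then show ?thesis by (simp add: outside)
  qed
  have bnd: "A x \<in> l2 q \<and> l2_norm q (A x) \<le> C * l2_norm q x" if x: "x \<in> l2 q" for x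
  proof (intro conjI)
    have out: "A x \<sigma> = 0" if "\<sigma> \<notin> ?V" for \<sigma>
      using that by (simp add: A_def outside)
    have nn: "C * l2_norm q x \<ge> 0" using C by (simp add: l2_norm_nonneg)
    have sec: "(\<Sum>\<sigma>\<in>G. (cmod (A x \<sigma>))\<^sup>2) \<le> (C * l2_norm q x)\<^sup>2"
      if G: "finite G" "G \<subseteq> ?V" for G
    proof (rule tendsto_upperbound)
      have "((\<lambda>F. \<Sum>\<tau>\<in>F. K \<sigma> \<tau> * x \<tau>) \<longlongrightarrow> A x \<sigma>) (finite_subsets_at_top ?V)" for \<sigma>
        unfolding A_def by (rule infsum_tendsto[OF summ[OF x]])
      then show "((\<lambda>F. \<Sum>\<sigma>\<in>G. (cmod (\<Sum>\<tau>\<in>F. K \<sigma> \<tau> * x \<tau>))\<^sup>2) \<longlongrightarrow> (\<Sum>\<sigma>\<in>G. (cmod (A x \<sigma>))\<^sup>2))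
          (finite_subsets_at_top ?V)"
        by (intro tendsto_intros)
      show "\<forall>\<^sub>F F in finite_subsets_at_top ?V.
          (\<Sum>\<sigma>\<in>G. (cmod (\<Sum>\<tau>\<in>F. K \<sigma> \<tau> * x \<tau>))\<^sup>2) \<le> (C * l2_norm q x)\<^sup>2"
      proof (rule eventually_finite_subsets_at_top_weakI)
        fix F assume F: "finite F" "F \<subseteq> ?V"
        have "(\<Sum>\<sigma>\<in>G. (cmod (\<Sum>\<tau>\<in>F. K \<sigma> \<tau> * x \<tau>))\<^sup>2) \<le> C\<^sup>2 * (\<Sum>\<tau>\<in>F. (cmod (x \<tau>))\<^sup>2)"
          by (rule form_bound_section[OF K F G])
        also have "\<dots> \<le> C\<^sup>2 * (l2_norm q x)\<^sup>2"
          by (intro mult_left_mono sum_le_l2_norm_square x F) auto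
        finally show "(\<Sum>\<sigma>\<in>G. (cmod (\<Sum>\<tau>\<in>F. K \<sigma> \<tau> * x \<tau>))\<^sup>2) \<le> (C * l2_norm q x)\<^sup>2"
          by (simp add: power_mult_distrib)
      qed
    qed simp
    show "A x \<in> l2 q" by (rule l2I_norm_le(1)[OF out nn sec])
    show "l2_norm q (A x) \<le> C * l2_norm q x" by (rule l2I_norm_le(2)[OF out nn sec])
  qed
  have "bounded_operator q A"
    unfolding bounded_operator_def
  proof (intro conjI ballI allI)
    fix x y assume "x \<in> l2 q" "y \<in> l2 q"
    then show "A (\<lambda>\<sigma>. x \<sigma> + y \<sigma>) = (\<lambda>\<sigma>. A x \<sigma> + A y \<sigma>)"
      by (simp add: A_def distrib_left infsum_add summ)
  next
    fix c x assume "x \<in> l2 q"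
    then show "A (\<lambda>\<sigma>. c * x \<sigma>) = (\<lambda>\<sigma>. c * A x \<sigma>)"
      by (simp add: A_def mult.left_commute infsum_cmult_right summ)
  qed (use bnd in auto)
  moreover have "operator_kernel q A = K"
  proof (intro ext)
    fix \<sigma> \<tau>
    show "operator_kernel q A \<sigma> \<tau> = K \<sigma> \<tau>"
    proof (cases "\<sigma> \<in> ?V \<and> \<tau> \<in> ?V")
      case True
      have "((\<lambda>\<rho>. K \<sigma> \<rho> * delta \<tau> \<rho>) has_sum (\<Sum>\<rho>\<in>{\<tau>}. K \<sigma> \<rho>)) ?V"
        by (rule has_sum_finite_neutralI[of "{\<tau>}"]) (use True in \<open>auto simp: delta_def\<close>)
      then show ?thesis
        using True by (simp add: operator_kernel_def l2_inner_delta A_def infsumI)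
    qed (auto simp: operator_kernel_def outside)
  qed
  ultimately show ?thesis
    unfolding represents_bounded_operator_def by blast
qed

lemma operator_norm_le:
  assumes A: "bounded_operator q A" and K: "form_bound q (operator_kernel q A) C"
  shows "operator_norm q A \<le> C"
  unfolding operator_norm_def
proof (rule cSUP_least)
  show "l2 q \<noteq> {}" using restrict_to_finite(1)[of "{}" q] by blast
  fix x assume x: "x \<in> l2 q"
  have "C \<ge> 0" using K by (simp add: form_bound_def)
  then show "l2_norm q (A x) / l2_norm q x \<le> C"
    using l2_norm_le_form_bound[OF A K x] l2_norm_nonneg[of q x]
    by (cases "l2_norm q x = 0") (auto simp: field_simps)
qed

lemma form_bound_operator_norm:
  assumes A: "bounded_operator q A"
  shows "form_bound q (operator_kernel q A) (operator_norm q A)"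
proof -
  obtain B where B: "\<And>x. x \<in> l2 q \<Longrightarrow> l2_norm q (A x) \<le> B * l2_norm q x"
    using A unfolding bounded_operator_def by blast
  have "l2_norm q (A x) / l2_norm q x \<le> max B 0" if "x \<in> l2 q" for x
    using B[OF that] l2_norm_nonneg[of q x]
    by (cases "l2_norm q x = 0") (auto simp: divide_simps le_max_iff_disj)
  then have bdd: "bdd_above ((\<lambda>x. l2_norm q (A x) / l2_norm q x) ` l2 q)"
    by (auto simp: bdd_above_def)
  have up: "l2_norm q (A x) / l2_norm q x \<le> operator_norm q A" if "x \<in> l2 q" for x
    unfolding operator_norm_def using bdd that by (intro cSUP_upper)
  show ?thesis
  proof (rule form_bound_operator_kernel[OF A])
    have "0 \<le> l2_norm q (A (restrict_to {} (\<lambda>_. 0))) / l2_norm q (restrict_to {} (\<lambda>_. 0))"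
      by (simp add: l2_norm_nonneg)
    also have "\<dots> \<le> operator_norm q A"
      by (rule up) (rule restrict_to_finite; simp)
    finally show "0 \<le> operator_norm q A" .
    fix x assume x: "x \<in> l2 q"
    show "l2_norm q (A x) \<le> operator_norm q A * l2_norm q x"
    proof (cases "l2_norm q x = 0")
      case True
      then show ?thesis using B[OF x] by simp
    next
      case False
      then have "l2_norm q x > 0" using l2_norm_nonneg[of q x] by simp
      then show ?thesis using up[OF x] by (simp add: field_simps)
    qed
  qed
qed

section \<open>Fourier coefficients on the circle\<close>

lemma space_circle_measure [simp]: "space circle_measure = UNIV"
  by (simp add: circle_measure_def)

lemma borel_measurable_circle_iff: "f \<in> borel_measurable circle_measure \<longleftrightarrow> f \<in> borel_measurable lebesgue"
  by (simp add: circle_measure_def measurable_def)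

lemma borel_measurable_circleI: "f \<in> borel_measurable borel \<Longrightarrow> f \<in> borel_measurable circle_measure"
  unfolding borel_measurable_circle_iff by (simp add: measurable_completion)

lemma emeasure_fundamental_domain: "emeasure lebesgue {0..<2 * pi} = ennreal (2 * pi)"
  by (simp add: emeasure_lborel_Ico)

interpretation circle: prob_space circle_measure
  unfolding circle_measure_def
  by (rule prob_space_uniform_measure) (simp_all add: emeasure_fundamental_domain)

lemma AE_circle_iff:
  "(AE \<theta> in circle_measure. P \<theta>) \<longleftrightarrow> (AE \<theta> in lebesgue. \<theta> \<in> {0..<2 * pi} \<longrightarrow> P \<theta>)"
  unfolding circle_measure_def by (rule AE_uniform_measure) (simp_all add: emeasure_fundamental_domain)

lemma circle_measure_density:
  "circle_measure = density lebesgue (\<lambda>\<theta>. ennreal (indicator {0..<2 * pi} \<theta> / (2 * pi)))"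
  unfolding circle_measure_def uniform_measure_def emeasure_fundamental_domain
  using divide_ennreal[of 1 "2 * pi"]
  by (intro arg_cong2[where f=density] refl ext) (auto split: split_indicator)

lemma integral_circle:
  fixes f :: "real \<Rightarrow> complex"
  assumes "f \<in> borel_measurable borel"
  shows "(LINT \<theta>|circle_measure. f \<theta>)
    = (LBINT \<theta>. indicator {0..2 * pi} \<theta> *\<^sub>R f \<theta>) / of_real (2 * pi)"
proof -
  have [measurable]: "f \<in> borel_measurable borel" by fact
  have "(LINT \<theta>|circle_measure. f \<theta>)
      = (LINT \<theta>|lebesgue. (indicator {0..<2 * pi} \<theta> / (2 * pi)) *\<^sub>R f \<theta>)"
    unfolding circle_measure_density
    by (rule integral_density) (auto simp: measurable_completion)
  also have "\<dots> = (LBINT \<theta>. (indicator {0..<2 * pi} \<theta> / (2 * pi)) *\<^sub>R f \<theta>)"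
    by (rule integral_completion) measurable
  also have "\<dots> = (LBINT \<theta>. (indicator {0..2 * pi} \<theta> *\<^sub>R f \<theta>) / of_real (2 * pi))"
  proof (rule integral_cong_AE)
    show "AE \<theta> in lborel. (indicator {0..<2 * pi} \<theta> / (2 * pi)) *\<^sub>R f \<theta>
        = (indicator {0..2 * pi} \<theta> *\<^sub>R f \<theta>) / of_real (2 * pi)"
      using AE_lborel_singleton[of "2 * pi"]
      by eventually_elim (auto simp: indicator_def scaleR_conv_of_real)
  qed measurable
  finally show ?thesis by simp
qed

lemma borel_measurable_cis_mult [measurable]: "(\<lambda>\<theta>::real. cis (c * \<theta>)) \<in> borel_measurable borel"
  by (intro borel_measurable_continuous_onI continuous_intros)

lemma integral_cis:
  "(LINT \<theta>|circle_measure. cis (of_int n * \<theta>)) = (if n = 0 then 1 else 0)"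
proof (cases "n = 0")
  case True
  then show ?thesis using circle.prob_space by simp
next
  case False
  define F where "F \<theta> = cis (of_int n * \<theta>) / (\<i> * of_int n)" for \<theta> :: real
  have "(LBINT \<theta>. indicator {0..2 * pi} \<theta> *\<^sub>R cis (of_int n * \<theta>)) = F (2 * pi) - F 0"
  proof (rule integral_FTC_Icc)
    fix \<theta> :: real
    show "(F has_vector_derivative cis (of_int n * \<theta>)) (at \<theta> within {0..2 * pi})"
    proof -
      have "((\<lambda>z. exp (\<i> * (of_int n * z)) / (\<i> * of_int n)) has_field_derivative
          cis (of_int n * \<theta>)) (at (of_real \<theta>))"
        using False by (auto intro!: derivative_eq_intros simp: cis_conv_exp field_simps)
      from has_vector_derivative_real_field[OF this] show ?thesis
        by (simp add: F_def[abs_def] cis_conv_exp)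
    qed
  qed (auto intro!: continuous_intros)
  also have "F (2 * pi) = F 0"
    using cis_multiple_2pi[of "real_of_int n"] by (simp add: F_def mult.commute)
  finally show ?thesis
    using False by (simp add: integral_circle)
qed

lemma integrable_mult_bounded:
  fixes h g :: "real \<Rightarrow> complex"
  assumes "integrable circle_measure h" "g \<in> borel_measurable circle_measure"
    and "AE \<theta> in circle_measure. cmod (g \<theta>) \<le> B"
  shows "integrable circle_measure (\<lambda>\<theta>. h \<theta> * g \<theta>)"
proof (rule Bochner_Integration.integrable_bound)
  show "integrable circle_measure (\<lambda>\<theta>. of_real B * h \<theta>)" using assms by simp
  have [measurable]: "h \<in> borel_measurable circle_measure" "g \<in> borel_measurable circle_measure"
    using assms by auto
  show "(\<lambda>\<theta>. h \<theta> * g \<theta>) \<in> borel_measurable circle_measure" by measurable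
  show "AE \<theta> in circle_measure. cmod (h \<theta> * g \<theta>) \<le> cmod (of_real B * h \<theta>)"
    using assms(3)
  proof eventually_elim
    case (elim \<theta>)
    then have "cmod (h \<theta>) * cmod (g \<theta>) \<le> cmod (h \<theta>) * \<bar>B\<bar>"
      by (intro mult_left_mono) auto
    then show ?case by (simp add: norm_mult mult.commute)
  qed
qed

lemma integrable_bounded_circle:
  fixes g :: "real \<Rightarrow> complex"
  assumes "g \<in> borel_measurable circle_measure" "AE \<theta> in circle_measure. cmod (g \<theta>) \<le> B"
  shows "integrable circle_measure g"
  using assms(2,1) by (rule circle.integrable_const_bound)

text \<open>
  The vanishing of all Fourier coefficients is phrased for products with every exponential, because
  in this form the class is a module over the trigonometric polynomials.
\<close>

definition annihilates_exponentials :: "(real \<Rightarrow> complex) \<Rightarrow> bool" where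
  "annihilates_exponentials h \<longleftrightarrow> integrable circle_measure h \<and>
     (\<forall>n. (LINT \<theta>|circle_measure. h \<theta> * cis (of_int n * \<theta>)) = 0)"

lemma annihilates_integrable_mult_cis:
  "annihilates_exponentials h \<Longrightarrow> integrable circle_measure (\<lambda>\<theta>. h \<theta> * cis (of_int n * \<theta>))"
  by (rule integrable_mult_bounded[where B = 1])
    (auto simp: annihilates_exponentials_def
      intro!: borel_measurable_circleI)

lemma annihilates_lincomb:
  assumes "annihilates_exponentials g" "annihilates_exponentials h"
  shows "annihilates_exponentials (\<lambda>\<theta>. a * g \<theta> + b * h \<theta>)"
  using assms annihilates_integrable_mult_cis[OF assms(1)] annihilates_integrable_mult_cis[OF assms(2)]
  by (simp add: annihilates_exponentials_def distrib_right mult.assoc)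

lemma annihilates_mult_cis:
  assumes "annihilates_exponentials h"
  shows "annihilates_exponentials (\<lambda>\<theta>. h \<theta> * cis (of_int m * \<theta>))"
proof -
  have "h \<theta> * cis (of_int m * \<theta>) * cis (of_int n * \<theta>) = h \<theta> * cis (of_int (m + n) * \<theta>)" for n \<theta>
    by (simp add: mult.assoc cis_mult distrib_right)
  with assms annihilates_integrable_mult_cis[OF assms] show ?thesis
    unfolding annihilates_exponentials_def by presburger
qed

text \<open>
  A real linear functional of \<open>cis \<theta>\<close> is a combination of \<open>cis \<theta>\<close> and \<open>cis (- \<theta>)\<close>. Products are
  handled by applying the induction hypothesis to the function \<open>h\<close> already multiplied by a factor, which is
  why the induction quantifies over \<open>h\<close>.
\<close>

lemma annihilates_mult_polynomial:
  assumes "real_polynomial_function p" "annihilates_exponentials h"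
  shows "annihilates_exponentials (\<lambda>\<theta>. h \<theta> * of_real (p (cis \<theta>)))"
  using assms
proof (induction p arbitrary: h rule: real_polynomial_function.induct)
  case (linear p)
  interpret bounded_linear p by fact
  define a b where "a = (of_real (p 1) - \<i> * of_real (p \<i>)) / (2 :: complex)"
    and "b = (of_real (p 1) + \<i> * of_real (p \<i>)) / (2 :: complex)"
  have "of_real (p (cis \<theta>)) = a * cis (of_int 1 * \<theta>) + b * cis (of_int (-1) * \<theta>)" for \<theta>
  proof -
    have "p (cis \<theta>) = p (cos \<theta> *\<^sub>R 1 + sin \<theta> *\<^sub>R \<i>)"
      by (rule arg_cong[of _ _ p]) (simp add: complex_eq_iff)
    also have "\<dots> = cos \<theta> * p 1 + sin \<theta> * p \<i>"
      by (simp add: add scaleR)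
    finally show ?thesis
      by (simp add: a_def b_def complex_eq_iff field_simps)
  qed
  then have "(\<lambda>\<theta>. h \<theta> * of_real (p (cis \<theta>)))
      = (\<lambda>\<theta>. a * (h \<theta> * cis (of_int 1 * \<theta>)) + b * (h \<theta> * cis (of_int (-1) * \<theta>)))"
    by (auto simp: algebra_simps)
  then show ?case
    using annihilates_lincomb[OF annihilates_mult_cis[OF linear.prems] annihilates_mult_cis[OF linear.prems]]
    by (simp only:)
next
  case (const c)
  then show ?case
    using annihilates_lincomb[OF const const, of "of_real c" 0] by (simp add: mult.commute)
next
  case (add p1 p2)
  then show ?case
    using annihilates_lincomb[OF add.IH(1)[OF add.prems] add.IH(2)[OF add.prems], of 1 1]
    by (simp add: distrib_left)
next
  case (mult p1 p2)
  show ?case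
    using mult.IH(2)[OF mult.IH(1)[OF mult.prems]] by (simp add: mult.assoc)
qed

text \<open>
  By Stone-Weierstrass, continuous functions on the circle are uniform limits of polynomials in \<open>cos \<theta>\<close>
  and \<open>sin \<theta>\<close>, against which \<open>h\<close> integrates to 0.
\<close>

lemma integral_mult_continuous_eq_0:
  assumes h: "annihilates_exponentials h" and \<phi>: "continuous_on (sphere 0 1) \<phi>"
  shows "(LINT \<theta>|circle_measure. h \<theta> * \<phi> (cis \<theta>)) = 0"
proof -
  have h': "integrable circle_measure h" using h by (simp add: annihilates_exponentials_def)
  define I where "I = (LINT \<theta>|circle_measure. cmod (h \<theta>))"
  have "cmod (LINT \<theta>|circle_measure. h \<theta> * \<phi> (cis \<theta>)) \<le> e * I" if "e > 0" for e
  proof -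
    obtain p where p: "polynomial_function p" and pe: "\<And>z. z \<in> sphere 0 1 \<Longrightarrow> cmod (\<phi> z - p z) < e"
      using Stone_Weierstrass_polynomial_function[OF compact_sphere \<phi> \<open>e > 0\<close>] by blast
    have "real_polynomial_function (Re \<circ> p)" "real_polynomial_function (Im \<circ> p)"
      using p bounded_linear_Re bounded_linear_Im by (auto simp: polynomial_function_def)
    then have "annihilates_exponentials (\<lambda>\<theta>. h \<theta> * of_real ((Re \<circ> p) (cis \<theta>)))"
      "annihilates_exponentials (\<lambda>\<theta>. h \<theta> * of_real ((Im \<circ> p) (cis \<theta>)))"
      using h by - (rule annihilates_mult_polynomial; assumption)+
    then have "annihilates_exponentials (\<lambda>\<theta>. 1 * (h \<theta> * of_real ((Re \<circ> p) (cis \<theta>)))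
        + \<i> * (h \<theta> * of_real ((Im \<circ> p) (cis \<theta>))))"
      by (rule annihilates_lincomb)
    moreover have "1 * (h \<theta> * of_real ((Re \<circ> p) (cis \<theta>))) + \<i> * (h \<theta> * of_real ((Im \<circ> p) (cis \<theta>)))
        = h \<theta> * p (cis \<theta>)" for \<theta>
      using complex_eq[of "p (cis \<theta>)"] by (simp add: algebra_simps) (metis distrib_left mult.left_commute)
    ultimately have hp: "annihilates_exponentials (\<lambda>\<theta>. h \<theta> * p (cis \<theta>))"
      by simp
    have p0: "(LINT \<theta>|circle_measure. h \<theta> * p (cis \<theta>)) = 0"
      using hp[unfolded annihilates_exponentials_def, THEN conjunct2, rule_format, of 0] by simp
    have "continuous_on UNIV (\<lambda>\<theta>. \<phi> (cis \<theta>))"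
      by (rule continuous_on_compose2[OF \<phi>, of UNIV cis]) (auto intro!: continuous_intros)
    moreover have "continuous_on UNIV (\<lambda>\<theta>. p (cis \<theta>))"
      using continuous_polymonial_function[OF p]
      by (intro continuous_on_compose2[of UNIV p UNIV cis])
        (auto intro!: continuous_intros simp: continuous_at_imp_continuous_on)
    ultimately have cont: "continuous_on UNIV (\<lambda>\<theta>. \<phi> (cis \<theta>) - p (cis \<theta>))"
      by (rule continuous_on_diff)
    have int: "integrable circle_measure (\<lambda>\<theta>. h \<theta> * (\<phi> (cis \<theta>) - p (cis \<theta>)))"
      by (rule integrable_mult_bounded[OF h', where B = e])
        (use cont pe in \<open>auto intro!: borel_measurable_circleI borel_measurable_continuous_onI less_imp_le\<close>)
    have "(LINT \<theta>|circle_measure. h \<theta> * \<phi> (cis \<theta>))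
        = (LINT \<theta>|circle_measure. h \<theta> * (\<phi> (cis \<theta>) - p (cis \<theta>)) + h \<theta> * p (cis \<theta>))"
      by (simp add: algebra_simps)
    also have "\<dots> = (LINT \<theta>|circle_measure. h \<theta> * (\<phi> (cis \<theta>) - p (cis \<theta>)))"
      using int hp p0 by (simp add: annihilates_exponentials_def)
    also have "cmod \<dots> \<le> (LINT \<theta>|circle_measure. cmod (h \<theta> * (\<phi> (cis \<theta>) - p (cis \<theta>))))"
      by (rule integral_norm_bound)
    also have "\<dots> \<le> (LINT \<theta>|circle_measure. e * cmod (h \<theta>))"
    proof (rule integral_mono)
      fix \<theta> :: real
      have "cmod (\<phi> (cis \<theta>) - p (cis \<theta>)) \<le> e" using pe[of "cis \<theta>"] by simp
      then show "cmod (h \<theta> * (\<phi> (cis \<theta>) - p (cis \<theta>))) \<le> e * cmod (h \<theta>)"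
        by (simp add: norm_mult mult.commute[of e] mult_left_mono)
    qed (use int h' in auto)
    finally show ?thesis by (simp add: I_def)
  qed
  then have "cmod (LINT \<theta>|circle_measure. h \<theta> * \<phi> (cis \<theta>)) \<le> 0 + e" if "e > 0" for e
  proof -
    have "I \<ge> 0" by (simp add: I_def)
    then have "e / (I + 1) * I \<le> e" using \<open>e > 0\<close> by (simp add: field_simps)
    then show ?thesis
      using \<open>\<And>e. e > 0 \<Longrightarrow> cmod (LINT \<theta>|circle_measure. h \<theta> * \<phi> (cis \<theta>)) \<le> e * I\<close>[of "e / (I + 1)"]
        \<open>e > 0\<close> \<open>I \<ge> 0\<close> by simp
  qed
  then have "cmod (LINT \<theta>|circle_measure. h \<theta> * \<phi> (cis \<theta>)) \<le> 0"
    by (rule field_le_epsilon)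
  then show ?thesis by simp
qed

text \<open>
  A loop descends to a continuous function on the circle; the constant homotopy from the loop to itself
  puts it in the form of a homotopy of loops.
\<close>

lemma continuous_on_circle_of_periodic:
  fixes \<phi> :: "real \<Rightarrow> complex"
  assumes "continuous_on {0..2 * pi} \<phi>" "\<phi> 0 = \<phi> (2 * pi)"
  shows "continuous_on (sphere 0 1) (\<lambda>z. \<phi> (Arg2pi z))"
proof -
  define p where "p t = \<phi> (2 * pi * t)" for t
  have "path p"
    unfolding path_def p_def
    by (intro continuous_on_compose2[OF assms(1)] continuous_intros) auto
  then have "homotopic_loops UNIV p p"
    using assms(2) by (simp add: homotopic_loops_refl pathfinish_def pathstart_def p_def)
  from homotopic_with_imp_continuous[OF homotopic_loops_imp_homotopic_circlemaps[OF this]]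
  show ?thesis by (simp add: p_def o_def)
qed

lemma Arg2pi_cis: "0 \<le> \<theta> \<Longrightarrow> \<theta> < 2 * pi \<Longrightarrow> Arg2pi (cis \<theta>) = \<theta>"
  by (rule Arg2pi_unique[of 1]) (simp_all add: cis_conv_exp)

text \<open>
  Multiplying \<open>h\<close> by its conjugate phase \<open>s\<close> gives \<open>cmod (h \<theta>)\<close>. Almost everywhere \<open>s\<close> is the limit of
  continuous functions on the line; clipping them to the unit disc and cutting them off at the end
  points of the period makes them bounded functions on the circle, against which \<open>h\<close> integrates to 0.
\<close>

lemma annihilates_exponentials_imp_AE_0:
  assumes h: "annihilates_exponentials h"
  shows "AE \<theta> in circle_measure. h \<theta> = 0"
proof -
  have h': "integrable circle_measure h" using h by (simp add: annihilates_exponentials_def)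
  then have h_meas: "h \<in> borel_measurable lebesgue"
    using borel_measurable_integrable[OF h'] by (simp only: borel_measurable_circle_iff)
  (* Where h vanishes, the quotient is 0 by convention. *)
  define s where "s \<theta> = cnj (h \<theta>) / of_real (cmod (h \<theta>))" for \<theta>
  have s_le: "cmod (s \<theta>) \<le> 1" for \<theta> by (simp add: s_def norm_divide)
  have hs: "h \<theta> * s \<theta> = of_real (cmod (h \<theta>))" for \<theta>
    by (cases "h \<theta> = 0") (auto simp: s_def field_simps complex_norm_square[symmetric] power2_eq_square)
  have s_meas: "s \<in> borel_measurable lebesgue" unfolding s_def
    by (intro borel_measurable_divide measurable_compose[OF h_meas] borel_measurable_continuous_onI
        continuous_intros)
  then have "s measurable_on UNIV"
    by (rule lebesgue_measurable_imp_measurable_on) simp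
  then obtain N g where N: "negligible N" and g: "\<And>n. continuous_on UNIV (g n)"
    and lim: "\<And>\<theta>. \<theta> \<notin> N \<Longrightarrow> (\<lambda>n. g n \<theta>) \<longlonglongrightarrow> s \<theta>"
    unfolding measurable_on_def by auto
  define cutoff where "cutoff n \<theta> = min 1 (real n * (\<theta> * (2 * pi - \<theta>)))" for n \<theta>
  define clip where "clip z = z / of_real (max 1 (cmod z))" for z :: complex
  define \<phi> where "\<phi> n \<theta> = of_real (cutoff n \<theta>) * clip (g n \<theta>)" for n \<theta>
  have clip_le: "cmod (clip z) \<le> 1" for z
    by (simp add: clip_def norm_divide divide_le_eq)
  have contc: "continuous_on UNIV clip"
    unfolding clip_def by (intro continuous_intros) (auto simp: max_def)
  have cont: "continuous_on UNIV (\<phi> n)" for n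
    unfolding \<phi>_def cutoff_def
    by (intro continuous_intros continuous_on_compose2[OF contc g]) auto
  have \<Phi>: "continuous_on (sphere 0 1) (\<lambda>z. \<phi> n (Arg2pi z))" for n
  proof (rule continuous_on_circle_of_periodic)
    show "continuous_on {0..2 * pi} (\<phi> n)" by (rule continuous_on_subset[OF cont]) simp
    show "\<phi> n 0 = \<phi> n (2 * pi)" by (simp add: \<phi>_def cutoff_def)
  qed
  (* Arg2pi has values in [0, 2 * pi), where the cutoff lies between 0 and 1. *)
  have \<Phi>_le: "cmod (\<phi> n (Arg2pi (cis \<theta>))) \<le> 1" for n \<theta>
  proof -
    define t where "t = Arg2pi (cis \<theta>)"
    have "0 \<le> t" "t \<le> 2 * pi"
      using Arg2pi_ge_0[of "cis \<theta>"] Arg2pi_lt_2pi[of "cis \<theta>"] by (simp_all add: t_def)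
    then have "0 \<le> real n * (t * (2 * pi - t))" by (intro mult_nonneg_nonneg) auto
    then have "\<bar>cutoff n t\<bar> \<le> 1" unfolding cutoff_def by linarith
    then have "\<bar>cutoff n t\<bar> * cmod (clip (g n t)) \<le> 1 * 1"
      using clip_le by (intro mult_mono) auto
    then show ?thesis by (simp add: \<phi>_def norm_mult t_def)
  qed
  have "continuous_on UNIV (\<lambda>\<theta>. \<phi> n (Arg2pi (cis \<theta>)))" for n
    by (rule continuous_on_compose2[OF \<Phi>, of UNIV cis]) (auto intro!: continuous_intros)
  then have meas: "(\<lambda>\<theta>. \<phi> n (Arg2pi (cis \<theta>))) \<in> borel_measurable circle_measure" for n
    by (intro borel_measurable_circleI borel_measurable_continuous_onI)
  have "(\<lambda>n. LINT \<theta>|circle_measure. h \<theta> * \<phi> n (Arg2pi (cis \<theta>)))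
      \<longlonglongrightarrow> (LINT \<theta>|circle_measure. h \<theta> * s \<theta>)"
  proof (rule integral_dominated_convergence)
    show "integrable circle_measure (\<lambda>\<theta>. cmod (h \<theta>))" using h' by simp
    show "(\<lambda>\<theta>. h \<theta> * s \<theta>) \<in> borel_measurable circle_measure"
      unfolding borel_measurable_circle_iff by (rule borel_measurable_times[OF h_meas s_meas])
    show "(\<lambda>\<theta>. h \<theta> * \<phi> n (Arg2pi (cis \<theta>))) \<in> borel_measurable circle_measure" for n
      by (rule borel_measurable_times[OF borel_measurable_integrable[OF h'] meas])
    show "AE \<theta> in circle_measure. cmod (h \<theta> * \<phi> n (Arg2pi (cis \<theta>))) \<le> cmod (h \<theta>)" for n
      by (rule AE_I2) (simp only: norm_mult mult_left_le[OF \<Phi>_le norm_ge_zero])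
    have "AE \<theta> in lebesgue. \<theta> \<notin> N \<union> {0}"
      using N by (intro AE_not_in) (auto simp: negligible_iff_null_sets[symmetric] negligible_Un)
    then show "AE \<theta> in circle_measure. (\<lambda>n. h \<theta> * \<phi> n (Arg2pi (cis \<theta>))) \<longlonglongrightarrow> h \<theta> * s \<theta>"
      unfolding AE_circle_iff
    proof eventually_elim
      case (elim \<theta>)
      show ?case
      proof
        assume \<theta>: "\<theta> \<in> {0..<2 * pi}"
        with elim have pos: "\<theta> * (2 * pi - \<theta>) > 0" by auto
        have "(\<lambda>n. clip (g n \<theta>)) \<longlonglongrightarrow> clip (s \<theta>)"
          using contc lim elim by (auto intro!: continuous_on_tendsto_compose[of UNIV clip])
        moreover have "clip (s \<theta>) = s \<theta>" using s_le[of \<theta>] by (simp add: clip_def)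
        moreover have "(\<lambda>n. cutoff n \<theta>) \<longlonglongrightarrow> 1"
        proof (rule tendsto_eventually)
          obtain m where m: "1 < real m * (\<theta> * (2 * pi - \<theta>))"
            using ex_less_of_nat_mult[OF pos] by blast
          show "\<forall>\<^sub>F n in sequentially. cutoff n \<theta> = 1"
          proof (rule eventually_sequentiallyI)
            fix n assume "m \<le> n"
            then have "real m * (\<theta> * (2 * pi - \<theta>)) \<le> real n * (\<theta> * (2 * pi - \<theta>))"
              using pos by (intro mult_right_mono) auto
            with m show "cutoff n \<theta> = 1" by (simp add: cutoff_def)
          qed
        qed
        ultimately have "(\<lambda>n. \<phi> n \<theta>) \<longlonglongrightarrow> of_real 1 * s \<theta>"
          unfolding \<phi>_def by (intro tendsto_intros) auto
        then show "(\<lambda>n. h \<theta> * \<phi> n (Arg2pi (cis \<theta>))) \<longlonglongrightarrow> h \<theta> * s \<theta>"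
          using \<theta> by (intro tendsto_intros) (simp add: Arg2pi_cis)
      qed
    qed
  qed
  then have "(LINT \<theta>|circle_measure. h \<theta> * s \<theta>) = 0"
    unfolding integral_mult_continuous_eq_0[OF h \<Phi>] by (simp add: LIMSEQ_const_iff)
  then have "(LINT \<theta>|circle_measure. cmod (h \<theta>)) = 0"
    by (simp add: hs)
  then show ?thesis
    using integral_nonneg_eq_0_iff_AE[of circle_measure "\<lambda>\<theta>. cmod (h \<theta>)"] h' by simp
qed

section \<open>Fejer means and bounded Toeplitz forms\<close>

text \<open>
  The hypothesis on \<open>I\<close> makes the sequence Cauchy in mean square: \<open>I\<close> is increasing and bounded. Along
  a subsequence the consecutive differences are then summable in mean, hence almost everywhere.
\<close>

lemma (in prob_space) AE_convergent_subsequence: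
  fixes g :: "nat \<Rightarrow> 'a \<Rightarrow> complex" and I :: "nat \<Rightarrow> real"
  assumes meas [measurable]: "\<And>n. g n \<in> borel_measurable M"
    and bound: "\<And>n x. cmod (g n x) \<le> B"
    and incr: "\<And>m n. m \<le> n \<Longrightarrow> (LINT x|M. (cmod (g n x - g m x))\<^sup>2) \<le> I n - I m"
    and I_le: "\<And>n. I n \<le> C"
  obtains r where "strict_mono r" "AE x in M. convergent (\<lambda>k. g (r k) x)"
proof -
  have "mono I"
  proof (rule monoI)
    fix m n :: nat assume "m \<le> n"
    have "0 \<le> (LINT x|M. (cmod (g n x - g m x))\<^sup>2)" by simp
    with incr[OF \<open>m \<le> n\<close>] show "I m \<le> I n" by linarith
  qed
  then obtain L where "I \<longlonglongrightarrow> L"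
    using incseq_convergent[of I C] I_le by blast
  then have "Cauchy I" by (rule LIMSEQ_imp_Cauchy)
  have "\<exists>N. \<forall>m\<ge>N. \<forall>n\<ge>N. I n - I m \<le> (1/4) ^ k" for k
  proof -
    obtain N where "\<And>m n. m \<ge> N \<Longrightarrow> n \<ge> N \<Longrightarrow> dist (I n) (I m) < (1/4) ^ k"
      using \<open>Cauchy I\<close> by (metis Cauchy_def zero_less_power zero_less_divide_1_iff zero_less_numeral)
    then show ?thesis
      by (intro exI[of _ N]) (auto simp: dist_real_def abs_less_iff intro!: less_imp_le)
  qed
  then obtain N where N: "\<And>k m n. m \<ge> N k \<Longrightarrow> n \<ge> N k \<Longrightarrow> I n - I m \<le> (1/4) ^ k"
    by metis
  (* The partial sums are strictly increasing and dominate N. *)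
  define r where "r k = (\<Sum>i\<le>k. Suc (N i))" for k
  have r: "strict_mono r" by (simp add: strict_mono_Suc_iff r_def)
  have rN: "N k \<le> r k" for k
    unfolding r_def using member_le_sum[of k "{..k}" "\<lambda>i. Suc (N i)"] by simp
  define d where "d k x = cmod (g (r (Suc k)) x - g (r k) x)" for k x
  have d_meas [measurable]: "d k \<in> borel_measurable M" for k
    unfolding d_def by measurable
  have d_le: "d k x \<le> 2 * B" for k x
    using norm_triangle_ineq4[of "g (r (Suc k)) x" "g (r k) x"] bound[of "r (Suc k)" x] bound[of "r k" x]
    by (simp add: d_def)
  have d_nn: "0 \<le> d k x" for k x by (simp add: d_def)
  have d_int: "integrable M (d k)" for k
    using d_le d_nn by (intro integrable_const_bound[of _ "2 * B"]) auto
  have d2_int: "integrable M (\<lambda>x. (d k x)\<^sup>2)" for k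
    using power_mono[OF d_le d_nn, of k _ 2]
    by (intro integrable_const_bound[of _ "(2 * B)\<^sup>2"]) (auto simp: power_mult_distrib)
  have d_small: "(LINT x|M. d k x) \<le> (1/2) ^ k" for k
  proof -
    have "(LINT x|M. (d k x)\<^sup>2) \<le> I (r (Suc k)) - I (r k)"
      unfolding d_def using r by (intro incr) (simp add: strict_mono_less_eq)
    also have "\<dots> \<le> (1/4) ^ k"
      using r rN[of k] strict_mono_less_eq[OF r, of k "Suc k"] by (intro N) auto
    finally have d2: "(LINT x|M. (d k x)\<^sup>2) \<le> (1/4) ^ k" .
    have "(LINT x|M. d k x) \<le> (LINT x|M. (2 ^ k * (d k x)\<^sup>2 + (1/2) ^ k) / 2)"
    proof (rule integral_mono)
      fix x
      (* The mean is controlled by the mean square, with the weights balanced at d = 2 ^ (- k). *)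
      have "0 \<le> (2 ^ k * d k x - 1)\<^sup>2" by simp
      then show "d k x \<le> (2 ^ k * (d k x)\<^sup>2 + (1/2) ^ k) / 2"
        by (simp add: power2_eq_square field_simps)
    qed (use d_int d2_int in auto)
    also have "\<dots> = (2 ^ k * (LINT x|M. (d k x)\<^sup>2) + (1/2) ^ k) / 2"
      using d2_int prob_space by simp
    also have "\<dots> \<le> (2 ^ k * (1/4) ^ k + (1/2) ^ k) / 2"
      using d2 by (intro divide_right_mono add_right_mono mult_left_mono) auto
    also have "\<dots> = (1/2) ^ k"
      by (simp add: power_mult_distrib[symmetric])
    finally show ?thesis .
  qed
  have "(\<integral>\<^sup>+x. (\<Sum>k. ennreal (d k x)) \<partial>M) = (\<Sum>k. \<integral>\<^sup>+x. ennreal (d k x) \<partial>M)"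
    by (rule nn_integral_suminf) measurable
  also have "\<dots> \<le> (\<Sum>k. ennreal ((1/2) ^ k))"
    using d_int d_nn d_small
    by (intro suminf_le) (auto simp: nn_integral_eq_integral intro!: ennreal_leI)
  also have "\<dots> < \<infinity>"
    by (simp add: suminf_ennreal_eq[OF _ geometric_sums[of "1/2::real"]])
  finally have "(\<integral>\<^sup>+x. (\<Sum>k. ennreal (d k x)) \<partial>M) \<noteq> \<infinity>" by simp
  then have "AE x in M. (\<Sum>k. ennreal (d k x)) \<noteq> \<infinity>"
    by (intro nn_integral_PInf_AE) auto
  then have "AE x in M. convergent (\<lambda>k. g (r k) x)"
  proof eventually_elim
    case (elim x)
    then have "summable (\<lambda>k. d k x)"
      using d_nn by (intro summable_suminf_not_top) auto
    then have "summable (\<lambda>k. g (r (Suc k)) x - g (r k) x)"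
      unfolding d_def by (rule summable_norm_cancel)
    then have "convergent (\<lambda>n. g (r n) x - g (r 0) x)"
      unfolding summable_iff_convergent sum_lessThan_telescope[of "\<lambda>k. g (r k) x"] .
    then show ?case by (simp add: convergent_diff_const_right_iff)
  qed
  with r show ?thesis by (rule that)
qed

definition fejer_weight :: "nat \<Rightarrow> int \<Rightarrow> real" where
  "fejer_weight N n = max 0 (1 - \<bar>real_of_int n\<bar> / (real N + 1))"

text \<open>
  An integer power of \<open>z\<close> makes the mean a function of the point of the circle rather than of the
  angle, so that the limit is a function on the circle as well.
\<close>

definition fejer_mean :: "(int \<Rightarrow> complex) \<Rightarrow> nat \<Rightarrow> complex \<Rightarrow> complex" where
  "fejer_mean c N z = (\<Sum>n\<in>{- int N..int N}. of_real (fejer_weight N n) * c n * z powi n)"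

lemma fejer_weight_eq_0: "\<bar>n\<bar> > int N \<Longrightarrow> fejer_weight N n = 0"
  by (simp add: fejer_weight_def field_simps)

lemma fejer_weight_nonneg: "0 \<le> fejer_weight N n"
  by (simp add: fejer_weight_def)

lemma fejer_weight_mono: "m \<le> n \<Longrightarrow> fejer_weight m k \<le> fejer_weight n k"
  unfolding fejer_weight_def by (intro max.mono diff_left_mono divide_left_mono) auto

lemma fejer_weight_tendsto: "(\<lambda>N. fejer_weight N n) \<longlonglongrightarrow> 1"
proof -
  have "(\<lambda>N. \<bar>real_of_int n\<bar> / (real N + 1)) \<longlonglongrightarrow> 0"
    by real_asymp
  then have "(\<lambda>N. max 0 (1 - \<bar>real_of_int n\<bar> / (real N + 1))) \<longlonglongrightarrow> max 0 (1 - 0)"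
    by (intro tendsto_intros)
  then show ?thesis by (simp add: fejer_weight_def)
qed

lemma fejer_mean_cis:
  assumes "N \<le> P"
  shows "fejer_mean c N (cis \<theta>)
    = (\<Sum>n\<in>{- int P..int P}. of_real (fejer_weight N n) * c n * cis (of_int n * \<theta>))"
  unfolding fejer_mean_def cis_power_int
  by (rule sum.mono_neutral_left) (use assms fejer_weight_eq_0 in \<open>auto simp: abs_le_iff not_le\<close>)

lemma card_difference_eq:
  "card {(j, k) \<in> {..N} \<times> {..N}. int j - int k = n} = nat (int N + 1 - \<bar>n\<bar>)"
proof (cases "n \<ge> 0")
  case True
  then have "{(j, k) \<in> {..N} \<times> {..N}. int j - int k = n} = (\<lambda>k. (k + nat n, k)) ` {k. k + nat n \<le> N}"
    by (auto simp: image_iff)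
  also have "card \<dots> = card {k. k + nat n \<le> N}"
    by (rule card_image) (auto simp: inj_on_def)
  also have "{k. k + nat n \<le> N} = {..<nat (int N + 1 - n)}" using True by auto
  finally show ?thesis using True by simp
next
  case False
  then have "{(j, k) \<in> {..N} \<times> {..N}. int j - int k = n} = (\<lambda>j. (j, j + nat (- n))) ` {j. j + nat (- n) \<le> N}"
    by (auto simp: image_iff)
  also have "card \<dots> = card {j. j + nat (- n) \<le> N}"
    by (rule card_image) (auto simp: inj_on_def)
  also have "{j. j + nat (- n) \<le> N} = {..<nat (int N + 1 + n)}" using False by auto
  finally show ?thesis using False by simp
qed

text \<open>
  The difference \<open>n\<close> occurs \<open>N + 1 - \<bar>n\<bar>\<close> times among pairs of indices up to \<open>N\<close>: averaging a Toeplitz matrix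
  produces Fejer weights.
\<close>

lemma sum_over_differences:
  fixes G :: "int \<Rightarrow> complex"
  shows "(\<Sum>j\<le>N. \<Sum>k\<le>N. G (int j - int k))
    = of_nat (Suc N) * (\<Sum>n\<in>{- int N..int N}. of_real (fejer_weight N n) * G n)"
proof -
  have "(\<Sum>j\<le>N. \<Sum>k\<le>N. G (int j - int k)) = (\<Sum>x\<in>{..N} \<times> {..N}. G ((\<lambda>(j, k). int j - int k) x))"
    by (simp add: sum.cartesian_product case_prod_unfold)
  also have "\<dots> = (\<Sum>n\<in>{- int N..int N}.
      of_nat (card {x \<in> {..N} \<times> {..N}. (\<lambda>(j, k). int j - int k) x = n}) * G n)"
    by (rule sum_fun_comp) auto
  also have "\<dots> = (\<Sum>n\<in>{- int N..int N}. of_nat (Suc N) * (of_real (fejer_weight N n) * G n))"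
  proof (rule sum.cong[OF refl])
    fix n assume n: "n \<in> {- int N..int N}"
    have "{x \<in> {..N} \<times> {..N}. (\<lambda>(j, k). int j - int k) x = n}
        = {(j, k) \<in> {..N} \<times> {..N}. int j - int k = n}" by auto
    then have c: "card {x \<in> {..N} \<times> {..N}. (\<lambda>(j, k). int j - int k) x = n} = nat (int N + 1 - \<bar>n\<bar>)"
      by (simp only: card_difference_eq)
    have "real (nat (int N + 1 - \<bar>n\<bar>)) = real N + 1 - \<bar>real_of_int n\<bar>"
      using n by (auto simp: of_nat_nat)
    also have "\<dots> = real (Suc N) * (1 - \<bar>real_of_int n\<bar> / (real N + 1))"
      by (simp add: right_diff_distrib add.commute)
    also have "1 - \<bar>real_of_int n\<bar> / (real N + 1) = fejer_weight N n"
    proof -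
      have "\<bar>real_of_int n\<bar> \<le> real N" using n by auto
      then have "\<bar>real_of_int n\<bar> / (real N + 1) \<le> 1" by (simp add: divide_le_eq)
      then show ?thesis by (simp add: fejer_weight_def)
    qed
    finally have "of_nat (nat (int N + 1 - \<bar>n\<bar>)) = (of_nat (Suc N) * of_real (fejer_weight N n) :: complex)"
      by (metis of_real_mult of_real_of_nat_eq)
    then show "of_nat (card {x \<in> {..N} \<times> {..N}. (\<lambda>(j, k). int j - int k) x = n}) * G n
        = of_nat (Suc N) * (of_real (fejer_weight N n) * G n)"
      unfolding c by (simp only: mult.assoc)
  qed
  finally show ?thesis by (simp only: sum_distrib_left)
qed

lemma cis_diff_eq: "cis (of_int (n - m) * \<theta>) = cis (of_int n * \<theta>) * cnj (cis (of_int m * \<theta>))"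
  by (simp add: cis_cnj cis_mult left_diff_distrib)

lemma integrable_cis: "integrable circle_measure (\<lambda>\<theta>. a * cis (of_int n * \<theta>))"
  by (rule integrable_bounded_circle[where B = "cmod a"])
    (auto simp: norm_mult intro!: borel_measurable_circleI)

lemma parseval_trig_polynomial:
  fixes a :: "int \<Rightarrow> complex"
  assumes "finite S"
  shows "(LINT \<theta>|circle_measure. (cmod (\<Sum>n\<in>S. a n * cis (of_int n * \<theta>)))\<^sup>2) = (\<Sum>n\<in>S. (cmod (a n))\<^sup>2)"
proof -
  have eq: "of_real ((cmod (\<Sum>n\<in>S. a n * cis (of_int n * \<theta>)))\<^sup>2)
      = (\<Sum>n\<in>S. \<Sum>m\<in>S. (a n * cnj (a m)) * cis (of_int (n - m) * \<theta>))" for \<theta>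
    unfolding complex_norm_square cnj_sum sum_product
    by (intro sum.cong refl) (simp only: cis_diff_eq complex_cnj_mult mult.assoc mult.left_commute)
  have "complex_of_real (LINT \<theta>|circle_measure. (cmod (\<Sum>n\<in>S. a n * cis (of_int n * \<theta>)))\<^sup>2)
      = (LINT \<theta>|circle_measure. of_real ((cmod (\<Sum>n\<in>S. a n * cis (of_int n * \<theta>)))\<^sup>2))"
    by (rule integral_complex_of_real[symmetric])
  also have "\<dots> = (\<Sum>n\<in>S. \<Sum>m\<in>S. (a n * cnj (a m)) * (LINT \<theta>|circle_measure. cis (of_int (n - m) * \<theta>)))"
    unfolding eq
    by (subst Bochner_Integration.integral_sum;
        (intro Bochner_Integration.integrable_sum integrable_cis)?)
      (subst Bochner_Integration.integral_sum; (intro integrable_cis)?; simp)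
  also have "\<dots> = (\<Sum>n\<in>S. a n * cnj (a n))"
    unfolding integral_cis using assms by (simp add: if_distrib sum.delta' cong: if_cong)
  also have "\<dots> = of_real (\<Sum>n\<in>S. (cmod (a n))\<^sup>2)"
    by (simp flip: complex_norm_square of_real_power)
  finally show ?thesis by (simp only: of_real_eq_iff)
qed

text \<open>
  The classical theorem on bounded Toeplitz matrices. With \<open>a k = b k = cis (- k * \<theta>)\<close> the form is
  \<open>N + 1\<close> times the Fejer mean at \<open>\<theta>\<close>, so all Fejer means are bounded by \<open>M\<close>. As the weights increase with
  \<open>N\<close> and \<open>(u - v)^2 \<le> u^2 - v^2\<close> for \<open>0 \<le> v \<le> u\<close>, Parseval yields the hypothesis of
  \<open>AE_convergent_subsequence\<close>. The uniform bound allows passing to the limit in the coefficients.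
\<close>

theorem bounded_toeplitz_sections_imp_symbol:
  fixes c :: "int \<Rightarrow> complex"
  assumes sections: "\<And>N a b. cmod (\<Sum>j\<le>N. \<Sum>k\<le>N. c (int j - int k) * a k * cnj (b j))
      \<le> M * ((\<Sum>j\<le>N. (cmod (a j))\<^sup>2) + (\<Sum>j\<le>N. (cmod (b j))\<^sup>2)) / 2"
  obtains f where "(\<lambda>\<theta>. f (cis \<theta>)) \<in> borel_measurable circle_measure"
    and "AE \<theta> in circle_measure. cmod (f (cis \<theta>)) \<le> M" and "fourier_coeff f = c"
proof -
  define g where "g N \<theta> = fejer_mean c N (cis \<theta>)" for N \<theta>
  have g_sum: "g N \<theta> = (\<Sum>n\<in>{- int P..int P}. of_real (fejer_weight N n) * c n * cis (of_int n * \<theta>))"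
    if "N \<le> P" for N P \<theta>
    unfolding g_def by (rule fejer_mean_cis[OF that])
  have g_le: "cmod (g N \<theta>) \<le> M" for N \<theta>
  proof -
    define a where "a k = cis (- (real k * \<theta>))" for k :: nat
    have "c (int j - int k) * a k * cnj (a j) = c (int j - int k) * cis (of_int (int j - int k) * \<theta>)" for j k
      unfolding cis_diff_eq by (simp add: a_def cis_cnj)
    then have "(\<Sum>j\<le>N. \<Sum>k\<le>N. c (int j - int k) * a k * cnj (a j)) = of_nat (Suc N) * g N \<theta>"
      by (simp only: sum_over_differences[of "\<lambda>n. c n * cis (of_int n * \<theta>)" N]
          g_sum[OF order_refl] mult.assoc)
    moreover have "cmod (\<Sum>j\<le>N. \<Sum>k\<le>N. c (int j - int k) * a k * cnj (a j)) \<le> M * (real (Suc N) + real (Suc N)) / 2"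
      using sections[of a a N] by (simp add: a_def)
    ultimately have "real (Suc N) * cmod (g N \<theta>) \<le> real (Suc N) * M"
      by (simp add: norm_mult algebra_simps del: of_nat_Suc)
    then show ?thesis by simp
  qed
  have g_meas [measurable]: "g N \<in> borel_measurable circle_measure" for N
    unfolding g_sum[OF order_refl, abs_def]
    by (intro borel_measurable_sum borel_measurable_times borel_measurable_const borel_measurable_circleI
        borel_measurable_cis_mult)
  define I where "I N = (LINT \<theta>|circle_measure. (cmod (g N \<theta>))\<^sup>2)" for N
  have I_eq: "I N = (\<Sum>n\<in>{- int P..int P}. (fejer_weight N n)\<^sup>2 * (cmod (c n))\<^sup>2)" if "N \<le> P" for N P
    unfolding I_def g_sum[OF that] parseval_trig_polynomial[OF finite_atLeastAtMost_int]
    by (simp add: norm_mult power_mult_distrib)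
  have I_le: "I N \<le> M\<^sup>2" for N
  proof -
    have "I N \<le> (LINT \<theta>|circle_measure. M\<^sup>2)"
      unfolding I_def
    proof (rule integral_mono)
      show "integrable circle_measure (\<lambda>\<theta>. (cmod (g N \<theta>))\<^sup>2)"
        using g_le by (intro circle.integrable_const_bound[of _ "M\<^sup>2"]) (auto intro!: power_mono)
    qed (use g_le in \<open>auto intro!: power_mono\<close>)
    then show ?thesis using circle.prob_space by simp
  qed
  have incr: "(LINT \<theta>|circle_measure. (cmod (g n \<theta> - g m \<theta>))\<^sup>2) \<le> I n - I m" if "m \<le> n" for m n
  proof -
    have d: "g n \<theta> - g m \<theta> = (\<Sum>k\<in>{- int n..int n}.
        (of_real (fejer_weight n k - fejer_weight m k) * c k) * cis (of_int k * \<theta>))" for \<theta>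
      unfolding g_sum[OF that] g_sum[of n n, OF order_refl] by (simp add: sum_subtractf left_diff_distrib)
    have "(LINT \<theta>|circle_measure. (cmod (g n \<theta> - g m \<theta>))\<^sup>2)
        = (\<Sum>k\<in>{- int n..int n}. (fejer_weight n k - fejer_weight m k)\<^sup>2 * (cmod (c k))\<^sup>2)"
      unfolding d parseval_trig_polynomial[OF finite_atLeastAtMost_int]
      by (simp only: norm_mult norm_of_real power_mult_distrib power2_abs)
    also have "\<dots> \<le> (\<Sum>k\<in>{- int n..int n}. ((fejer_weight n k)\<^sup>2 - (fejer_weight m k)\<^sup>2) * (cmod (c k))\<^sup>2)"
    proof (intro sum_mono mult_right_mono)
      fix k
      have "0 \<le> 2 * fejer_weight m k * (fejer_weight n k - fejer_weight m k)"
        using fejer_weight_mono[OF that, of k] fejer_weight_nonneg[of m k] by simp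
      then show "(fejer_weight n k - fejer_weight m k)\<^sup>2 \<le> (fejer_weight n k)\<^sup>2 - (fejer_weight m k)\<^sup>2"
        by (simp add: power2_eq_square algebra_simps)
    qed simp
    also have "\<dots> = I n - I m"
      unfolding I_eq[OF that] I_eq[of n n, OF order_refl] by (simp add: sum_subtractf left_diff_distrib)
    finally show ?thesis .
  qed
  obtain r where r: "strict_mono r" and conv: "AE \<theta> in circle_measure. convergent (\<lambda>k. g (r k) \<theta>)"
    by (rule circle.AE_convergent_subsequence[OF g_meas g_le incr I_le])
  define f where "f z = lim (\<lambda>k. fejer_mean c (r k) z)" for z
  have lim: "AE \<theta> in circle_measure. (\<lambda>k. g (r k) \<theta>) \<longlonglongrightarrow> f (cis \<theta>)"
    using conv by eventually_elim (simp add: f_def g_def convergent_LIMSEQ_iff)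
  have f_meas: "(\<lambda>\<theta>. f (cis \<theta>)) \<in> borel_measurable circle_measure"
    unfolding f_def g_def[symmetric] by (intro borel_measurable_lim_metric g_meas)
  have f_le: "AE \<theta> in circle_measure. cmod (f (cis \<theta>)) \<le> M"
    using lim
  proof eventually_elim
    case (elim \<theta>)
    show ?case
      by (rule tendsto_upperbound[OF tendsto_norm[OF elim]]) (use g_le in auto)
  qed
  have "fourier_coeff f m = c m" for m
  proof -
    have "(\<lambda>k. LINT \<theta>|circle_measure. g (r k) \<theta> * cis (of_int (- m) * \<theta>))
        \<longlonglongrightarrow> (LINT \<theta>|circle_measure. f (cis \<theta>) * cis (of_int (- m) * \<theta>))"
    proof (rule integral_dominated_convergence)
      show "integrable circle_measure (\<lambda>\<theta>. M)" by simp
      show "AE \<theta> in circle_measure. (\<lambda>k. g (r k) \<theta> * cis (of_int (- m) * \<theta>))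
          \<longlonglongrightarrow> f (cis \<theta>) * cis (of_int (- m) * \<theta>)"
        using lim by eventually_elim (intro tendsto_intros)
      show "AE \<theta> in circle_measure. cmod (g (r k) \<theta> * cis (of_int (- m) * \<theta>)) \<le> M" for k
        using g_le by (simp add: norm_mult)
    qed (intro borel_measurable_times f_meas g_meas borel_measurable_circleI borel_measurable_cis_mult)+
    moreover have "\<forall>\<^sub>F k in sequentially. (LINT \<theta>|circle_measure. g (r k) \<theta> * cis (of_int (- m) * \<theta>))
        = of_real (fejer_weight (r k) m) * c m"
    proof (rule eventually_sequentiallyI)
      fix k assume "nat \<bar>m\<bar> \<le> k"
      also have "k \<le> r k" using r by (rule strict_mono_imp_increasing)
      finally have m: "m \<in> {- int (r k)..int (r k)}" by auto
      have "(LINT \<theta>|circle_measure. g (r k) \<theta> * cis (of_int (- m) * \<theta>))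
          = (LINT \<theta>|circle_measure. (\<Sum>n\<in>{- int (r k)..int (r k)}.
              (of_real (fejer_weight (r k) n) * c n) * cis (of_int (n - m) * \<theta>)))"
        unfolding g_sum[OF order_refl] sum_distrib_right
        by (intro Bochner_Integration.integral_cong sum.cong refl)
          (simp add: cis_mult left_diff_distrib)
      also have "\<dots> = (\<Sum>n\<in>{- int (r k)..int (r k)}.
          (of_real (fejer_weight (r k) n) * c n) * (if n - m = 0 then 1 else 0))"
        by (subst Bochner_Integration.integral_sum; (intro integrable_cis)?)
          (simp only: integral_mult_right_zero integral_cis)
      also have "\<dots> = of_real (fejer_weight (r k) m) * c m"
        using m by (simp add: if_distrib sum.delta' cong: if_cong)
      finally show "(LINT \<theta>|circle_measure. g (r k) \<theta> * cis (of_int (- m) * \<theta>))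
          = of_real (fejer_weight (r k) m) * c m" .
    qed
    ultimately have "(\<lambda>k. of_real (fejer_weight (r k) m) * c m)
        \<longlonglongrightarrow> (LINT \<theta>|circle_measure. f (cis \<theta>) * cis (of_int (- m) * \<theta>))"
      by (rule Lim_transform_eventually)
    moreover have "(\<lambda>k. of_real (fejer_weight (r k) m) * c m) \<longlonglongrightarrow> of_real 1 * c m"
      by (intro tendsto_intros LIMSEQ_subseq_LIMSEQ[OF fejer_weight_tendsto r, unfolded o_def])
    ultimately show ?thesis
      using LIMSEQ_unique by (fastforce simp: fourier_coeff_def)
  qed
  then show ?thesis using that f_meas f_le by blast
qed

section \<open>The kernel as a compression of multiplication by the symbol\<close>

text \<open>
  The weight of a comparable pair on levels \<open>s\<close> and \<open>t\<close>: normalisations times the measure of the smaller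
  cylinder.
\<close>

lemma powr_weight:
  assumes "q > 0" "s \<le> N" "t \<le> N"
  shows "real (q ^ (N - max s t)) * (real q powr (real s / 2) * real q powr (real t / 2)) / real q ^ N
    = real q powr (- \<bar>real s - real t\<bar> / 2)"
proof -
  have q: "real q > 0" using assms by simp
  have "real (q ^ (N - max s t)) = real q powr (real N - real (max s t))"
    using assms q by (simp add: of_nat_diff flip: powr_realpow)
  moreover have "real q ^ N = real q powr real N"
    using q by (simp add: powr_realpow)
  ultimately have "real (q ^ (N - max s t)) * (real q powr (real s / 2) * real q powr (real t / 2)) / real q ^ N
      = real q powr ((real N - real (max s t)) + (real s / 2 + real t / 2) - real N)"
    by (simp only: powr_add powr_diff)
  also have "(real N - real (max s t)) + (real s / 2 + real t / 2) - real N = - \<bar>real s - real t\<bar> / 2"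
    by (auto simp: max_def field_simps)
  finally show ?thesis .
qed

text \<open>
  The value at \<open>(w, \<theta>)\<close> of the image of \<open>x\<close> under the isometry into functions on boundary times
  circle, for \<open>w\<close> at least as long as the words in \<open>F\<close>.
\<close>

definition branch_transform ::
    "nat \<Rightarrow> nat list set \<Rightarrow> (nat list \<Rightarrow> complex) \<Rightarrow> nat list \<Rightarrow> real \<Rightarrow> complex" where
  "branch_transform q F x w \<theta> =
     (\<Sum>\<tau>\<in>F. if prefix \<tau> w then x \<tau> * of_real (real q powr (real (length \<tau>) / 2)) * cis (real (length \<tau>) * \<theta>)
            else 0)"

text \<open>
  The inner product over the boundary alone, at a fixed \<open>\<theta>\<close>.
\<close>

definition branch_average ::
    "nat \<Rightarrow> nat \<Rightarrow> nat list set \<Rightarrow> (nat list \<Rightarrow> complex) \<Rightarrow> (nat list \<Rightarrow> complex) \<Rightarrow> real \<Rightarrow> complex" where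
  "branch_average q N F x y \<theta> =
     (\<Sum>w\<in>words q N. branch_transform q F x w \<theta> * cnj (branch_transform q F y w \<theta>)) / of_nat (q ^ N)"

lemma branch_average_eq:
  assumes q: "q > 0" and F: "finite F" "F \<subseteq> tree_vertices q" and N: "\<forall>\<sigma>\<in>F. length \<sigma> \<le> N"
  shows "branch_average q N F x y \<theta> =
    (\<Sum>\<sigma>\<in>F. \<Sum>\<tau>\<in>F. (Gamma_kernel q (\<lambda>_. 1) \<sigma> \<tau> * x \<tau> * cnj (y \<sigma>))
       * cis (of_int (int (length \<tau>) - int (length \<sigma>)) * \<theta>))"
proof -
  define X where "X x \<tau> = x \<tau> * of_real (real q powr (real (length \<tau>) / 2)) * cis (real (length \<tau>) * \<theta>)"
    for x :: "nat list \<Rightarrow> complex" and \<tau>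
  have "branch_transform q F x w \<theta> * cnj (branch_transform q F y w \<theta>)
      = (\<Sum>\<sigma>\<in>F. \<Sum>\<tau>\<in>F. if prefix \<sigma> w \<and> prefix \<tau> w then X x \<tau> * cnj (X y \<sigma>) else 0)" for w
    unfolding branch_transform_def X_def[symmetric] cnj_sum sum_product
    by (subst sum.swap, intro sum.cong refl) auto
  then have "branch_average q N F x y \<theta> = (\<Sum>w\<in>words q N. \<Sum>\<sigma>\<in>F. \<Sum>\<tau>\<in>F.
      if prefix \<sigma> w \<and> prefix \<tau> w then X x \<tau> * cnj (X y \<sigma>) else 0) / of_nat (q ^ N)"
    by (simp only: branch_average_def)
  also have "\<dots> = (\<Sum>\<sigma>\<in>F. \<Sum>\<tau>\<in>F. (\<Sum>w\<in>words q N.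
      if prefix \<sigma> w \<and> prefix \<tau> w then X x \<tau> * cnj (X y \<sigma>) else 0) / of_nat (q ^ N))"
    unfolding sum_divide_distrib
    by (rule trans[OF sum.swap], rule sum.cong[OF refl], rule sum.swap)
  also have "\<dots> = (\<Sum>\<sigma>\<in>F. \<Sum>\<tau>\<in>F. (Gamma_kernel q (\<lambda>_. 1) \<sigma> \<tau> * x \<tau> * cnj (y \<sigma>))
       * cis (of_int (int (length \<tau>) - int (length \<sigma>)) * \<theta>))"
  proof (intro sum.cong refl)
    fix \<sigma> \<tau> assume \<sigma>: "\<sigma> \<in> F" and \<tau>: "\<tau> \<in> F"
    let ?s = "length \<sigma>" and ?t = "length \<tau>"
    have V: "\<sigma> \<in> tree_vertices q" "\<tau> \<in> tree_vertices q" and len: "?s \<le> N" "?t \<le> N"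
      using \<sigma> \<tau> F N by auto
    have "(\<Sum>w\<in>words q N. if prefix \<sigma> w \<and> prefix \<tau> w then X x \<tau> * cnj (X y \<sigma>) else 0)
        = (\<Sum>w\<in>{w \<in> words q N. prefix \<sigma> w \<and> prefix \<tau> w}. X x \<tau> * cnj (X y \<sigma>))"
      by (rule sum.inter_filter[symmetric]) simp
    also have "\<dots> = of_nat (card {w \<in> words q N. prefix \<sigma> w \<and> prefix \<tau> w}) * (X x \<tau> * cnj (X y \<sigma>))"
      by simp
    finally have card: "(\<Sum>w\<in>words q N. if prefix \<sigma> w \<and> prefix \<tau> w then X x \<tau> * cnj (X y \<sigma>) else 0)
        = of_nat (card {w \<in> words q N. prefix \<sigma> w \<and> prefix \<tau> w}) * (X x \<tau> * cnj (X y \<sigma>))" .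
    have XX: "X x \<tau> * cnj (X y \<sigma>) = of_real (real q powr (real ?s / 2) * real q powr (real ?t / 2))
        * (x \<tau> * cnj (y \<sigma>) * cis (of_int (int ?t - int ?s) * \<theta>))"
      unfolding cis_diff_eq by (simp add: X_def)
    show "(\<Sum>w\<in>words q N. if prefix \<sigma> w \<and> prefix \<tau> w then X x \<tau> * cnj (X y \<sigma>) else 0) / of_nat (q ^ N)
        = (Gamma_kernel q (\<lambda>_. 1) \<sigma> \<tau> * x \<tau> * cnj (y \<sigma>)) * cis (of_int (int ?t - int ?s) * \<theta>)"
    proof (cases "comparable \<sigma> \<tau>")
      case True
      let ?w = "real q powr (real ?s / 2) * real q powr (real ?t / 2)"
        and ?e = "x \<tau> * cnj (y \<sigma>) * cis (of_int (int ?t - int ?s) * \<theta>)"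
      have "of_nat (q ^ (N - max ?s ?t)) * (of_real ?w * ?e) / of_nat (q ^ N)
          = of_real (real (q ^ (N - max ?s ?t)) * ?w / real q ^ N) * ?e"
        by simp
      note eq = this
      have "(\<Sum>w\<in>words q N. if prefix \<sigma> w \<and> prefix \<tau> w then X x \<tau> * cnj (X y \<sigma>) else 0) / of_nat (q ^ N)
          = of_nat (q ^ (N - max ?s ?t)) * (X x \<tau> * cnj (X y \<sigma>)) / of_nat (q ^ N)"
        by (simp only: card card_words_extending_both[OF V len] if_P[OF True])
      also have "\<dots> = of_real (real q powr (- \<bar>real ?s - real ?t\<bar> / 2)) * ?e"
        by (simp only: XX eq powr_weight[OF q len])
      also have "\<dots> = (Gamma_kernel q (\<lambda>_. 1) \<sigma> \<tau> * x \<tau> * cnj (y \<sigma>)) * cis (of_int (int ?t - int ?s) * \<theta>)"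
        by (simp only: Gamma_kernel_eq[OF q V] if_P[OF True] mult_1_right mult.assoc)
      finally show ?thesis .
    next
      case False
      then show ?thesis
        unfolding card card_words_extending_both[OF V len] by (simp add: Gamma_kernel_eq[OF q V])
    qed
  qed
  finally show ?thesis .
qed

lemma integrable_branch_average:
  assumes "q > 0" "finite F" "F \<subseteq> tree_vertices q" "\<forall>\<sigma>\<in>F. length \<sigma> \<le> N"
  shows "integrable circle_measure (branch_average q N F x y)"
  unfolding branch_average_eq[OF assms, abs_def]
  by (intro Bochner_Integration.integrable_sum integrable_cis)

text \<open>
  The kernel as a compression of multiplication by \<open>f\<close>.
\<close>

lemma Gamma_form_eq_integral:
  assumes q: "q > 0" and F: "finite F" "F \<subseteq> tree_vertices q" and N: "\<forall>\<sigma>\<in>F. length \<sigma> \<le> N"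
    and f: "integrable circle_measure (\<lambda>\<theta>. f (cis \<theta>))"
  shows "(\<Sum>\<sigma>\<in>F. \<Sum>\<tau>\<in>F. Gamma_kernel q (fourier_coeff f) \<sigma> \<tau> * x \<tau> * cnj (y \<sigma>))
    = (LINT \<theta>|circle_measure. f (cis \<theta>) * branch_average q N F x y \<theta>)"
proof -
  define A where "A \<sigma> \<tau> = Gamma_kernel q (\<lambda>_. 1) \<sigma> \<tau> * x \<tau> * cnj (y \<sigma>)" for \<sigma> \<tau>
  define e where "e \<sigma> \<tau> = int (length \<tau>) - int (length \<sigma>)" for \<sigma> \<tau> :: "nat list"
  have int: "integrable circle_measure (\<lambda>\<theta>. A \<sigma> \<tau> * (f (cis \<theta>) * cis (of_int (e \<sigma> \<tau>) * \<theta>)))" for \<sigma> \<tau>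
    by (intro integrable_mult_right integrable_mult_bounded[OF f, where B = 1] borel_measurable_circleI
        borel_measurable_cis_mult) simp
  have "(\<lambda>\<theta>. f (cis \<theta>) * branch_average q N F x y \<theta>)
      = (\<lambda>\<theta>. \<Sum>\<sigma>\<in>F. \<Sum>\<tau>\<in>F. A \<sigma> \<tau> * (f (cis \<theta>) * cis (of_int (e \<sigma> \<tau>) * \<theta>)))"
    unfolding branch_average_eq[OF q F N] A_def e_def
    by (simp only: sum_distrib_left mult.left_commute mult.assoc)
  then have "(LINT \<theta>|circle_measure. f (cis \<theta>) * branch_average q N F x y \<theta>)
      = (\<Sum>\<sigma>\<in>F. \<Sum>\<tau>\<in>F. A \<sigma> \<tau> * (LINT \<theta>|circle_measure. f (cis \<theta>) * cis (of_int (e \<sigma> \<tau>) * \<theta>)))"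
    using int by (simp add: Bochner_Integration.integral_sum Bochner_Integration.integrable_sum)
  also have "\<dots> = (\<Sum>\<sigma>\<in>F. \<Sum>\<tau>\<in>F. Gamma_kernel q (fourier_coeff f) \<sigma> \<tau> * x \<tau> * cnj (y \<sigma>))"
  proof (intro sum.cong refl)
    fix \<sigma> \<tau> assume "\<sigma> \<in> F" "\<tau> \<in> F"
    then have V: "\<sigma> \<in> tree_vertices q" "\<tau> \<in> tree_vertices q" using F by auto
    have "(LINT \<theta>|circle_measure. f (cis \<theta>) * cis (of_int (e \<sigma> \<tau>) * \<theta>))
        = fourier_coeff f (int (length \<sigma>) - int (length \<tau>))"
      by (simp add: fourier_coeff_def e_def left_diff_distrib)
    then show "A \<sigma> \<tau> * (LINT \<theta>|circle_measure. f (cis \<theta>) * cis (of_int (e \<sigma> \<tau>) * \<theta>))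
        = Gamma_kernel q (fourier_coeff f) \<sigma> \<tau> * x \<tau> * cnj (y \<sigma>)"
      using Gamma_kernel_eq[OF q V] by (simp add: A_def)
  qed
  finally show ?thesis ..
qed

text \<open>
  The transform is isometric: this is the preceding identity for the constant symbol 1, whose kernel is
  the identity.
\<close>

lemma integral_branch_average_self:
  assumes q: "q > 0" and F: "finite F" "F \<subseteq> tree_vertices q" and N: "\<forall>\<sigma>\<in>F. length \<sigma> \<le> N"
  shows "(LINT \<theta>|circle_measure. branch_average q N F x x \<theta>) = of_real (\<Sum>\<sigma>\<in>F. (cmod (x \<sigma>))\<^sup>2)"
proof -
  have fc: "fourier_coeff (\<lambda>_. 1) = (\<lambda>n. if n = 0 then 1 else 0)"
    using integral_cis[of "- n" for n] by (auto simp: fourier_coeff_def fun_eq_iff)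
  have "(LINT \<theta>|circle_measure. branch_average q N F x x \<theta>)
      = (\<Sum>\<sigma>\<in>F. \<Sum>\<tau>\<in>F. Gamma_kernel q (fourier_coeff (\<lambda>_. 1)) \<sigma> \<tau> * x \<tau> * cnj (x \<sigma>))"
    by (subst Gamma_form_eq_integral[OF q F N]) auto
  also have "\<dots> = (\<Sum>\<sigma>\<in>F. \<Sum>\<tau>\<in>F. if \<tau> = \<sigma> then x \<tau> * cnj (x \<sigma>) else 0)"
  proof (intro sum.cong refl)
    fix \<sigma> \<tau> assume "\<sigma> \<in> F" "\<tau> \<in> F"
    then have V: "\<sigma> \<in> tree_vertices q" "\<tau> \<in> tree_vertices q" using F by auto
    have "\<sigma> = \<tau>" if "comparable \<sigma> \<tau>" "length \<sigma> = length \<tau>"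
      using that by (auto simp: prefix_def)
    then show "Gamma_kernel q (fourier_coeff (\<lambda>_. 1)) \<sigma> \<tau> * x \<tau> * cnj (x \<sigma>)
        = (if \<tau> = \<sigma> then x \<tau> * cnj (x \<sigma>) else 0)"
      using q by (auto simp: Gamma_kernel_eq[OF q V] fc)
  qed
  also have "\<dots> = of_real (\<Sum>\<sigma>\<in>F. (cmod (x \<sigma>))\<^sup>2)"
    using F(1) by (simp add: sum.delta complex_norm_square del: of_real_power flip: complex_norm_square)
  finally show ?thesis .
qed

text \<open>
  At each \<open>\<theta>\<close> the average is a positive semidefinite form, so its off-diagonal values are dominated by the
  diagonal ones.
\<close>

lemma cmod_branch_average_le:
  "cmod (branch_average q N F x y \<theta>)
    \<le> (Re (branch_average q N F x x \<theta>) + Re (branch_average q N F y y \<theta>)) / 2"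
proof -
  define X Y where "X = (\<lambda>w. branch_transform q F x w \<theta>)" and "Y = (\<lambda>w. branch_transform q F y w \<theta>)"
  have diag: "Re (\<Sum>w\<in>words q N. z w * cnj (z w)) = (\<Sum>w\<in>words q N. (cmod (z w))\<^sup>2)" for z :: "nat list \<Rightarrow> complex"
  proof -
    have "Re (z w * cnj (z w)) = (cmod (z w))\<^sup>2" for w
      by (metis Re_complex_of_real complex_norm_square)
    then show ?thesis by (simp only: Re_sum)
  qed
  have "cmod (\<Sum>w\<in>words q N. X w * cnj (Y w)) \<le> (\<Sum>w\<in>words q N. cmod (X w) * cmod (Y w))"
    by (rule order_trans[OF norm_sum]) (simp add: norm_mult)
  also have "\<dots> \<le> (\<Sum>w\<in>words q N. ((cmod (X w))\<^sup>2 + (cmod (Y w))\<^sup>2) / 2)"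
  proof (rule sum_mono)
    fix w
    show "cmod (X w) * cmod (Y w) \<le> ((cmod (X w))\<^sup>2 + (cmod (Y w))\<^sup>2) / 2"
      using sum_squares_bound[of "cmod (X w)" "cmod (Y w)"] by simp
  qed
  also have "\<dots> = (Re (\<Sum>w\<in>words q N. X w * cnj (X w)) + Re (\<Sum>w\<in>words q N. Y w * cnj (Y w))) / 2"
    unfolding diag by (simp add: sum.distrib flip: sum_divide_distrib)
  finally have "cmod (\<Sum>w\<in>words q N. X w * cnj (Y w)) / real (q ^ N)
      \<le> (Re (\<Sum>w\<in>words q N. X w * cnj (X w)) + Re (\<Sum>w\<in>words q N. Y w * cnj (Y w))) / 2 / real (q ^ N)"
    by (rule divide_right_mono) simp
  moreover have "Re (z / of_nat (q ^ N)) = Re z / real (q ^ N)" for z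
    using Re_divide_of_real[of z "real (q ^ N)"] by simp
  moreover have "cmod (z / of_nat (q ^ N)) = cmod z / real (q ^ N)" for z
    by (simp add: norm_divide norm_power)
  ultimately show ?thesis
    unfolding branch_average_def X_def Y_def by (simp only: add_divide_distrib divide_divide_eq_left mult.commute)
qed

lemma form_bound_Gamma:
  assumes q: "q > 0" and f: "(\<lambda>\<theta>. f (cis \<theta>)) \<in> borel_measurable circle_measure"
    and L: "AE \<theta> in circle_measure. cmod (f (cis \<theta>)) \<le> L" "L \<ge> 0"
  shows "form_bound q (Gamma_kernel q (fourier_coeff f)) L"
  unfolding form_bound_def
proof (intro conjI allI impI, fact, elim conjE)
  fix F x y assume F: "finite F" "F \<subseteq> tree_vertices q"
  define N where "N = Max (length ` F \<union> {0})"
  have N: "\<forall>\<sigma>\<in>F. length \<sigma> \<le> N"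
    unfolding N_def using F by (intro ballI Max_ge) auto
  let ?P = "\<lambda>x y. branch_average q N F x y"
  note intP = integrable_branch_average[OF q F N]
  have intf: "integrable circle_measure (\<lambda>\<theta>. f (cis \<theta>))"
    by (rule integrable_bounded_circle[OF f L(1)])
  have intfP: "integrable circle_measure (\<lambda>\<theta>. f (cis \<theta>) * ?P x y \<theta>)"
    using integrable_mult_bounded[OF intP f L(1), of x y] by (simp only: mult.commute)
  have Re_P: "(LINT \<theta>|circle_measure. Re (?P x x \<theta>)) = (\<Sum>\<sigma>\<in>F. (cmod (x \<sigma>))\<^sup>2)" for x
    using integral_branch_average_self[OF q F N, of x] integral_Re[OF intP, of x x] by simp
  have "cmod (\<Sum>\<sigma>\<in>F. \<Sum>\<tau>\<in>F. Gamma_kernel q (fourier_coeff f) \<sigma> \<tau> * x \<tau> * cnj (y \<sigma>))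
      = cmod (LINT \<theta>|circle_measure. f (cis \<theta>) * ?P x y \<theta>)"
    by (simp only: Gamma_form_eq_integral[OF q F N intf])
  also have "\<dots> \<le> (LINT \<theta>|circle_measure. cmod (f (cis \<theta>) * ?P x y \<theta>))"
    by (rule integral_norm_bound)
  also have "\<dots> \<le> (LINT \<theta>|circle_measure. L * ((Re (?P x x \<theta>) + Re (?P y y \<theta>)) / 2))"
  proof (rule integral_mono_AE)
    show "integrable circle_measure (\<lambda>\<theta>. cmod (f (cis \<theta>) * ?P x y \<theta>))"
      using intfP by simp
    show "integrable circle_measure (\<lambda>\<theta>. L * ((Re (?P x x \<theta>) + Re (?P y y \<theta>)) / 2))"
      using intP by simp
    show "AE \<theta> in circle_measure. cmod (f (cis \<theta>) * ?P x y \<theta>) \<le> L * ((Re (?P x x \<theta>) + Re (?P y y \<theta>)) / 2)"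
      using L(1)
    proof eventually_elim
      case (elim \<theta>)
      then show ?case
        unfolding norm_mult using L(2) cmod_branch_average_le by (intro mult_mono) auto
    qed
  qed
  also have "\<dots> = L * ((\<Sum>\<sigma>\<in>F. (cmod (x \<sigma>))\<^sup>2) + (\<Sum>\<sigma>\<in>F. (cmod (y \<sigma>))\<^sup>2)) / 2"
    using intP by (simp add: Re_P)
  finally show "cmod (\<Sum>\<sigma>\<in>F. \<Sum>\<tau>\<in>F. Gamma_kernel q (fourier_coeff f) \<sigma> \<tau> * x \<tau> * cnj (y \<sigma>))
      \<le> L * ((\<Sum>\<sigma>\<in>F. (cmod (x \<sigma>))\<^sup>2) + (\<Sum>\<sigma>\<in>F. (cmod (y \<sigma>))\<^sup>2)) / 2" .
qed

section \<open>Radial vectors\<close>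

text \<open>
  Each vertex on the deeper level has exactly one ancestor on the other one.
\<close>

lemma card_comparable_words:
  "(\<Sum>\<sigma>\<in>words q j. \<Sum>\<tau>\<in>words q k. if comparable \<sigma> \<tau> then 1 else 0 :: nat) = q ^ max j k"
proof -
  have le: "(\<Sum>\<sigma>\<in>words q j. \<Sum>\<tau>\<in>words q k. if comparable \<sigma> \<tau> then 1 else 0 :: nat) = q ^ k"
    if "j \<le> k" for j k
  proof -
    have "(\<Sum>\<tau>\<in>words q k. if comparable \<sigma> \<tau> then 1 else 0 :: nat) = q ^ (k - j)" if \<sigma>: "\<sigma> \<in> words q j" for \<sigma>
    proof -
      have "comparable \<sigma> \<tau> \<longleftrightarrow> prefix \<sigma> \<tau>" if "\<tau> \<in> words q k" for \<tau>
        using \<sigma> that \<open>j \<le> k\<close> by (auto simp: words_def prefix_def)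
      then have "(\<Sum>\<tau>\<in>words q k. if comparable \<sigma> \<tau> then 1 else 0 :: nat)
          = (\<Sum>\<tau>\<in>words q k. if prefix \<sigma> \<tau> then 1 else 0)"
        by (intro sum.cong) auto
      also have "\<dots> = card {\<tau> \<in> words q k. prefix \<sigma> \<tau>}"
        by (simp add: sum.inter_filter[symmetric])
      finally show ?thesis
        using card_words_extending[of \<sigma> q k] \<sigma> \<open>j \<le> k\<close> by (auto simp: words_def)
    qed
    then have "(\<Sum>\<sigma>\<in>words q j. \<Sum>\<tau>\<in>words q k. if comparable \<sigma> \<tau> then 1 else 0 :: nat) = q ^ j * q ^ (k - j)"
      by (simp add: card_words)
    then show ?thesis using \<open>j \<le> k\<close> by (simp flip: power_add)
  qed
  show ?thesis
  proof (cases "j \<le> k")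
    case True
    then show ?thesis using le by (simp add: max_def)
  next
    case False
    then have "(\<Sum>\<tau>\<in>words q k. \<Sum>\<sigma>\<in>words q j. if comparable \<tau> \<sigma> then 1 else 0 :: nat) = q ^ j"
      by (intro le) simp
    with False show ?thesis
      by (subst sum.swap) (simp add: max_def disj_commute)
  qed
qed

text \<open>
  The number \<open>q ^ max j k\<close> of comparable pairs cancels all the weights, leaving the entry of a Toeplitz
  matrix.
\<close>

lemma Gamma_form_words:
  assumes q: "q > 0"
  shows "(\<Sum>\<sigma>\<in>words q j. \<Sum>\<tau>\<in>words q k.
      Gamma_kernel q c \<sigma> \<tau> * (a * of_real (real q powr (- real k / 2))) * cnj (b * of_real (real q powr (- real j / 2))))
    = c (int j - int k) * a * cnj b"
proof -
  define w where "w = real q powr (- \<bar>real j - real k\<bar> / 2) * (real q powr (- real k / 2) * real q powr (- real j / 2))"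
  have q': "real q > 0" using q by simp
  have "(\<Sum>\<sigma>\<in>words q j. \<Sum>\<tau>\<in>words q k.
      Gamma_kernel q c \<sigma> \<tau> * (a * of_real (real q powr (- real k / 2))) * cnj (b * of_real (real q powr (- real j / 2))))
    = (\<Sum>\<sigma>\<in>words q j. \<Sum>\<tau>\<in>words q k.
        of_nat (if comparable \<sigma> \<tau> then 1 else 0) * (of_real w * (c (int j - int k) * a * cnj b)))"
  proof (intro sum.cong refl)
    fix \<sigma> \<tau> assume \<sigma>: "\<sigma> \<in> words q j" and \<tau>: "\<tau> \<in> words q k"
    then have V: "\<sigma> \<in> tree_vertices q" "\<tau> \<in> tree_vertices q" "length \<sigma> = j" "length \<tau> = k"
      by (auto simp: words_def)
    show "Gamma_kernel q c \<sigma> \<tau> * (a * of_real (real q powr (- real k / 2))) * cnj (b * of_real (real q powr (- real j / 2)))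
      = of_nat (if comparable \<sigma> \<tau> then 1 else 0) * (of_real w * (c (int j - int k) * a * cnj b))"
      unfolding Gamma_kernel_eq[OF q V(1,2)] V(3,4) w_def by simp
  qed
  also have "\<dots> = of_nat (\<Sum>\<sigma>\<in>words q j. \<Sum>\<tau>\<in>words q k. if comparable \<sigma> \<tau> then 1 else 0)
      * (of_real w * (c (int j - int k) * a * cnj b))"
    by (simp only: of_nat_sum sum_distrib_right)
  also have "\<dots> = of_real (real q ^ max j k * w) * (c (int j - int k) * a * cnj b)"
    unfolding card_comparable_words by simp
  also have "real q ^ max j k * w
      = real q powr (real (max j k) + (- \<bar>real j - real k\<bar> / 2 + (- real k / 2 + - real j / 2)))"
    using q' by (simp only: w_def powr_add powr_realpow)
  also have "real (max j k) + (- \<bar>real j - real k\<bar> / 2 + (- real k / 2 + - real j / 2)) = 0"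
    by (auto simp: max_def field_simps)
  finally show ?thesis using q' by simp
qed

text \<open>
  The vectors \<open>lift u\<close> form the radial part of the space, an isometric copy of the square-summable
  sequences.
\<close>

lemma form_bound_Gamma_imp_sections:
  assumes q: "q > 0" and K: "form_bound q (Gamma_kernel q c) M"
  shows "cmod (\<Sum>j\<le>N. \<Sum>k\<le>N. c (int j - int k) * a k * cnj (b j))
      \<le> M * ((\<Sum>j\<le>N. (cmod (a j))\<^sup>2) + (\<Sum>j\<le>N. (cmod (b j))\<^sup>2)) / 2"
proof -
  define F where "F = (\<Union>j\<le>N. words q j)"
  define lift where "lift u \<sigma> = u (length \<sigma>) * of_real (real q powr (- real (length \<sigma>) / 2))"
    for u :: "nat \<Rightarrow> complex" and \<sigma> :: "nat list"
  have lift: "lift u \<sigma> = u j * of_real (real q powr (- real j / 2))" if "\<sigma> \<in> words q j" for u \<sigma> j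
    using that by (simp add: lift_def words_def)
  have "finite F" by (simp add: F_def)
  moreover have "F \<subseteq> tree_vertices q" by (auto simp: F_def words_def)
  ultimately have F: "finite F" "F \<subseteq> tree_vertices q" .
  have sumF: "(\<Sum>\<sigma>\<in>F. g \<sigma>) = (\<Sum>j\<le>N. \<Sum>\<sigma>\<in>words q j. g \<sigma>)" for g :: "nat list \<Rightarrow> 'a::comm_monoid_add"
  proof -
    have "\<forall>i\<in>{..N}. \<forall>j\<in>{..N}. i \<noteq> j \<longrightarrow> words q i \<inter> words q j = {}"
      by (auto simp: words_def)
    then show ?thesis
      unfolding F_def by (intro sum.UNION_disjoint) simp_all
  qed
  have norm: "(\<Sum>\<sigma>\<in>F. (cmod (lift u \<sigma>))\<^sup>2) = (\<Sum>j\<le>N. (cmod (u j))\<^sup>2)" for u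
    unfolding sumF
  proof (intro sum.cong refl)
    fix j
    have "(\<Sum>\<sigma>\<in>words q j. (cmod (lift u \<sigma>))\<^sup>2) = (\<Sum>\<sigma>\<in>words q j. (cmod (u j))\<^sup>2 * real q powr (- real j))"
      by (intro sum.cong refl)
        (simp add: lift norm_mult power_mult_distrib flip: powr_add mult_2 powr_numeral add: power2_eq_square)
    also have "\<dots> = (cmod (u j))\<^sup>2"
      using q by (simp add: card_words powr_minus powr_realpow)
    finally show "(\<Sum>\<sigma>\<in>words q j. (cmod (lift u \<sigma>))\<^sup>2) = (cmod (u j))\<^sup>2" .
  qed
  have "(\<Sum>\<sigma>\<in>F. \<Sum>\<tau>\<in>F. Gamma_kernel q c \<sigma> \<tau> * lift a \<tau> * cnj (lift b \<sigma>))
      = (\<Sum>j\<le>N. \<Sum>k\<le>N. \<Sum>\<sigma>\<in>words q j. \<Sum>\<tau>\<in>words q k. Gamma_kernel q c \<sigma> \<tau> * lift a \<tau> * cnj (lift b \<sigma>))"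
    unfolding sumF by (intro sum.cong refl) (rule sum.swap)
  also have "\<dots> = (\<Sum>j\<le>N. \<Sum>k\<le>N. c (int j - int k) * a k * cnj (b j))"
  proof (intro sum.cong refl)
    fix j k
    have "(\<Sum>\<sigma>\<in>words q j. \<Sum>\<tau>\<in>words q k. Gamma_kernel q c \<sigma> \<tau> * lift a \<tau> * cnj (lift b \<sigma>))
        = (\<Sum>\<sigma>\<in>words q j. \<Sum>\<tau>\<in>words q k. Gamma_kernel q c \<sigma> \<tau>
            * (a k * of_real (real q powr (- real k / 2))) * cnj (b j * of_real (real q powr (- real j / 2))))"
      by (intro sum.cong refl) (simp only: lift)
    then show "(\<Sum>\<sigma>\<in>words q j. \<Sum>\<tau>\<in>words q k. Gamma_kernel q c \<sigma> \<tau> * lift a \<tau> * cnj (lift b \<sigma>))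
        = c (int j - int k) * a k * cnj (b j)"
      by (simp only: Gamma_form_words[OF q])
  qed
  finally show ?thesis
    using form_boundD[OF K F, of "lift a" "lift b"] by (simp only: norm)
qed

section \<open>The symbol and the operator norm\<close>

text \<open>
  The essential supremum of a nonnegative function over a space of positive measure is nonnegative, so
  being below \<open>\<infinity>\<close> makes it a real number.
\<close>

lemma Linf_circle_bound:
  assumes "f \<in> Linf_circle"
  shows "AE \<theta> in circle_measure. cmod (f (cis \<theta>)) \<le> Linf_norm f" and "Linf_norm f \<ge> 0"
    and "circle_esssup f = ereal (Linf_norm f)"
proof -
  have fin: "circle_esssup f < \<infinity>" using assms by (simp add: Linf_circle_def)
  have ae: "AE \<theta> in circle_measure. ereal (cmod (f (cis \<theta>))) \<le> circle_esssup f"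
    unfolding circle_esssup_def by (rule esssup_AE)
  have "\<exists>\<theta>. ereal (cmod (f (cis \<theta>))) \<le> circle_esssup f"
  proof (rule ccontr)
    assume "\<nexists>\<theta>. ereal (cmod (f (cis \<theta>))) \<le> circle_esssup f"
    with ae have "AE \<theta> in circle_measure. False" by simp
    then show False by (simp only: circle.AE_False)
  qed
  then have "0 \<le> circle_esssup f"
    by (metis ereal_less_eq(5) norm_ge_zero order_trans)
  with fin show e: "circle_esssup f = ereal (Linf_norm f)" and "Linf_norm f \<ge> 0"
    unfolding Linf_norm_def by (cases "circle_esssup f"; simp)+
  show "AE \<theta> in circle_measure. cmod (f (cis \<theta>)) \<le> Linf_norm f"
    using ae unfolding e by simp
qed

lemma Linf_circleI:
  assumes f: "(\<lambda>\<theta>. f (cis \<theta>)) \<in> borel_measurable circle_measure"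
    and M: "AE \<theta> in circle_measure. cmod (f (cis \<theta>)) \<le> M"
  shows "f \<in> Linf_circle" and "Linf_norm f \<le> M"
proof -
  have "(\<lambda>\<theta>. ereal (cmod (f (cis \<theta>)))) \<in> borel_measurable circle_measure"
    by (rule measurable_compose[OF f]) measurable
  then have le: "circle_esssup f \<le> ereal M"
    unfolding circle_esssup_def using M by (intro esssup_I) auto
  then show "f \<in> Linf_circle" using f by (auto simp: Linf_circle_def)
  from Linf_circle_bound(3)[OF this] le show "Linf_norm f \<le> M" by simp
qed

lemma fourier_coeff_unique:
  assumes f: "integrable circle_measure (\<lambda>\<theta>. f (cis \<theta>))" and g: "integrable circle_measure (\<lambda>\<theta>. g (cis \<theta>))"
    and eq: "fourier_coeff f = fourier_coeff g"
  shows "AE \<theta> in circle_measure. f (cis \<theta>) = g (cis \<theta>)"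
proof -
  have int: "integrable circle_measure (\<lambda>\<theta>. h (cis \<theta>) * cis (of_int n * \<theta>))"
    if "integrable circle_measure (\<lambda>\<theta>. h (cis \<theta>))" for h :: "complex \<Rightarrow> complex" and n
    by (intro integrable_mult_bounded[OF that, where B = 1] borel_measurable_circleI
        borel_measurable_cis_mult) simp
  have "(LINT \<theta>|circle_measure. (f (cis \<theta>) - g (cis \<theta>)) * cis (of_int n * \<theta>)) = 0" for n
  proof -
    have "(LINT \<theta>|circle_measure. (f (cis \<theta>) - g (cis \<theta>)) * cis (of_int n * \<theta>))
        = fourier_coeff f (- n) - fourier_coeff g (- n)"
      using int[OF f, of n] int[OF g, of n] by (simp add: fourier_coeff_def left_diff_distrib)
    then show ?thesis by (simp add: eq)
  qed
  then have "annihilates_exponentials (\<lambda>\<theta>. f (cis \<theta>) - g (cis \<theta>))"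
    using f g by (simp add: annihilates_exponentials_def)
  from annihilates_exponentials_imp_AE_0[OF this] show ?thesis by simp
qed

theorem theorem1p2:
  fixes q :: nat
  assumes "q \<ge> 2"
  shows "B_Toep q = {Gamma_kernel q (fourier_coeff f) | f. f \<in> Linf_circle} \<and>
         (\<forall>f\<in>Linf_circle. \<forall>A. bounded_operator q A \<and>
              operator_kernel q A = Gamma_kernel q (fourier_coeff f) \<longrightarrow>
            operator_norm q A = Linf_norm f)"
proof (intro conjI ballI allI impI)
  have q: "q > 0" using assms by simp
  have upper: "form_bound q (Gamma_kernel q (fourier_coeff f)) (Linf_norm f)" if "f \<in> Linf_circle" for f
    using that Linf_circle_bound[OF that] by (intro form_bound_Gamma[OF q]) (auto simp: Linf_circle_def)
  have symbol: "\<exists>f \<in> Linf_circle. fourier_coeff f = c \<and> Linf_norm f \<le> operator_norm q A"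
    if A: "bounded_operator q A" "operator_kernel q A = Gamma_kernel q c" for A c
  proof -
    have "form_bound q (Gamma_kernel q c) (operator_norm q A)"
      using form_bound_operator_norm[OF A(1)] by (simp only: A(2))
    from bounded_toeplitz_sections_imp_symbol[OF form_bound_Gamma_imp_sections[OF q this]]
    obtain f where f: "(\<lambda>\<theta>. f (cis \<theta>)) \<in> borel_measurable circle_measure"
      "AE \<theta> in circle_measure. cmod (f (cis \<theta>)) \<le> operator_norm q A" "fourier_coeff f = c" .
    with Linf_circleI[OF f(1,2)] show ?thesis by blast
  qed
  show "B_Toep q = {Gamma_kernel q (fourier_coeff f) | f. f \<in> Linf_circle}"
  proof (intro equalityI subsetI)
    fix K assume "K \<in> B_Toep q"
    then obtain c A where "K = Gamma_kernel q c" "bounded_operator q A" "operator_kernel q A = K"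
      unfolding B_Toep_def Toep_eq_range_Gamma_kernel[OF q] represents_bounded_operator_def by blast
    with symbol[of A c] show "K \<in> {Gamma_kernel q (fourier_coeff f) | f. f \<in> Linf_circle}" by blast
  next
    fix K assume "K \<in> {Gamma_kernel q (fourier_coeff f) | f. f \<in> Linf_circle}"
    then obtain f where f: "f \<in> Linf_circle" and K: "K = Gamma_kernel q (fourier_coeff f)" by blast
    show "K \<in> B_Toep q"
      unfolding B_Toep_def Toep_eq_range_Gamma_kernel[OF q] K
      using form_bound_imp_represents[OF upper[OF f] Gamma_kernel_outside] by blast
  qed
  fix f A
  assume f: "f \<in> Linf_circle"
    and A: "bounded_operator q A \<and> operator_kernel q A = Gamma_kernel q (fourier_coeff f)"
  have "operator_norm q A \<le> Linf_norm f"
    using A upper[OF f] by (intro operator_norm_le) auto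
  moreover have "Linf_norm f \<le> operator_norm q A"
  proof -
    obtain g where g: "g \<in> Linf_circle" "fourier_coeff g = fourier_coeff f" "Linf_norm g \<le> operator_norm q A"
      using symbol A by blast
    have int: "integrable circle_measure (\<lambda>\<theta>. h (cis \<theta>))" if "h \<in> Linf_circle" for h
      using that Linf_circle_bound(1)[OF that]
      by (intro integrable_bounded_circle) (auto simp: Linf_circle_def)
    have "AE \<theta> in circle_measure. f (cis \<theta>) = g (cis \<theta>)"
      using fourier_coeff_unique[OF int[OF f] int[OF g(1)]] g(2) by simp
    with Linf_circle_bound(1)[OF g(1)]
    have "AE \<theta> in circle_measure. cmod (f (cis \<theta>)) \<le> Linf_norm g"
      by eventually_elim simp
    with f have "Linf_norm f \<le> Linf_norm g"
      by (intro Linf_circleI(2)) (auto simp: Linf_circle_def)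
    with g(3) show ?thesis by simp
  qed
  ultimately show "operator_norm q A = Linf_norm f" by (rule antisym)
qed

end
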